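(* Let $(X_n)_{n\in\mathbb{N}}$ be a sequence of $\mathbb{Z}$-valued random variables with laws $\mu_n$, mod-$\phi$ convergent with parameters $\lambda_n\to+\infty$, and let $(\nu_n)_{n\in\mathbb{N}}$ be a general approximation scheme of $(X_n)_{n\in\mathbb{N}}$, with $\widehat{\mu_n}=e^{\lambda_n\phi}\psi_n$, $\widehat{\nu_n}=e^{\lambda_n\phi}\chi_n$, $\psi_n\to\psi$, $\chi_n\to\chi$. Let $r\geq 0$ be an integer and assume that there are constants $\beta_n,\beta$ with $\beta_n\to\beta$ such that $$\psi_n(\xi)-\chi_n(\xi)=\beta_n\,(i\xi)^{r+1}\,(1+o_\xi(1))\ \text{ for all } n\in\mathbb{N},\qquad \psi(\xi)-\chi(\xi)=\beta\,(i\xi)^{r+1}\,(1+o_\xi(1)),$$ where the $o_\xi(1)$ converge to $0$ as $\xi\to 0$, uniformly in $n$. Then $$d_{\mathrm L}(\mu_n,\nu_n)=\frac{|\beta|\,|G_{r+1}(z_{r+2})|}{\sqrt{2\pi}\,(\sigma^2\lambda_n)^{\frac r2+1}}+o\!\left(\frac{1}{(\lambda_n)^{\frac r2+1}}\right)\qquad (n\to\infty).$$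
   Context: Fourier transforms: for a (finite signed) measure $\mu$ on $\mathbb{Z}$, $\widehat\mu(\xi)=\sum_{k\in\mathbb{Z}}\mu(\{k\})e^{ik\xi}$, a function on $\mathbb{T}=\mathbb{R}/2\pi\mathbb{Z}$. Reference law: $\phi$ is the ($2\pi$-periodic, continuous, $\phi(0)=0$) exponent of an infinitely divisible probability law on $\mathbb{Z}$ with Fourier transform $e^{\phi(\xi)}$; this law has a second moment and is not supported on any proper sublattice of $\mathbb{Z}$. Then $\phi$ is twice continuously differentiable and $\phi(\xi)=im\xi-\frac{\sigma^2\xi^2}{2}+o(\xi^2)$ near $0$, with $\sigma^2>0$. For $\lambda>0$, $e^{\lambda\phi}$ is the Fourier transform of an infinitely divisible law on $\mathbb{Z}$. General approximation scheme: $\mu_n$ is the law of $X_n$, $\nu_n$ is a signed measure on $\mathbb{Z}$, and $\widehat{\mu_n}(\xi)=e^{\lambda_n\phi(\xi)}\psi_n(\xi)$, $\widehat{\nu_n}(\xi)=e^{\lambda_n\phi(\xi)}\chi_n(\xi)$ with $\lambda_n\to+\infty$, $\psi_n\to\psi$ and $\chi_n\to\chi$ uniformly on $\mathbb{T}$. The residues $\psi_n,\psi,\chi_n,\chi$ are functions on $\mathbb{T}$ with absolutely convergent Fourier series, and $\chi_n(0)=\chi(0)=1$. Mod-$\phi$ convergence of $(X_n)$ with parameters $\lambda_n$ and limit $\psi$ means precisely this property of $\widehat{\mu_n}$. Local distance: $d_{\mathrm L}(\mu,\nu)=\sup_{k\in\mathbb{Z}}|\mu(\{k\})-\nu(\{k\})|$.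 Hermite functions: $G_r(\alpha)=\frac{d^r}{d\alpha^r}\big(e^{-\alpha^2/2}\big)=(-1)^rH_r(\alpha)e^{-\alpha^2/2}$, where $H_r$ is the $r$-th Hermite polynomial; $z_{r}$ denotes the smallest absolute value of a zero of $H_{r}$. *)

theory Defs
  imports "HOL-Probability.Probability" "HOL-Library.Landau_Symbols"
    "HOL-Computational_Algebra.Polynomial"
begin

(* A finite signed measure on the integers is encoded by its mass function k |-> m {k},
   which is absolutely summable. *)
definition finite_signed :: "(int \<Rightarrow> real) \<Rightarrow> bool" where
  "finite_signed m \<longleftrightarrow> (\<lambda>k. \<bar>m k\<bar>) summable_on UNIV"

definition fourier :: "(int \<Rightarrow> real) \<Rightarrow> real \<Rightarrow> complex" where
  "fourier m \<xi> = (\<Sum>\<^sub>\<infinity>k. complex_of_real (m k) * exp (\<i> * of_int k * of_real \<xi>))"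

definition local_dist :: "(int \<Rightarrow> real) \<Rightarrow> (int \<Rightarrow> real) \<Rightarrow> real" where
  "local_dist \<mu> \<nu> = (SUP k. \<bar>\<mu> k - \<nu> k\<bar>)"

(* For every n >= 1 the law p is that of a sum of n i.i.d. integer-valued variables. Allowing
   real-valued roots would change nothing in reference_law below: the n-th root has
   Fourier transform exp (phi / n), which is 2 pi-periodic, so it lives on the integers. *)
definition infinitely_divisible :: "int pmf \<Rightarrow> bool" where
  "infinitely_divisible p \<longleftrightarrow> (\<forall>n\<ge>1. \<exists>q. p = map_pmf sum_list (replicate_pmf n q))"

(* The proper sublattices are the subgroups d Z with d \<noteq> 1; d = 0 gives the trivial one. *)
definition nonlattice :: "int pmf \<Rightarrow> bool" where
  "nonlattice p \<longleftrightarrow> (\<forall>d::nat. d \<noteq> 1 \<longrightarrow> \<not> set_pmf p \<subseteq> range (\<lambda>j. int d * j))"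

definition reference_law :: "int pmf \<Rightarrow> (real \<Rightarrow> complex) \<Rightarrow> bool" where
  "reference_law p \<phi> \<longleftrightarrow>
     infinitely_divisible p \<and>
     integrable (measure_pmf p) (\<lambda>k. (real_of_int k)\<^sup>2) \<and>
     nonlattice p \<and>
     continuous_on UNIV \<phi> \<and>
     (\<forall>\<xi>. \<phi> (\<xi> + 2 * pi) = \<phi> \<xi>) \<and>
     \<phi> 0 = 0 \<and>
     (\<forall>\<xi>. fourier (pmf p) \<xi> = exp (\<phi> \<xi>))"

(* This determines m and \<sigma>\<^sup>2. For a reference law such m and \<sigma> exist and \<sigma>\<^sup>2 > 0: they
   are the mean and the standard deviation of p, which is not degenerate by nonlattice. *)
definition expansion_at_0 :: "(real \<Rightarrow> complex) \<Rightarrow> real \<Rightarrow> real \<Rightarrow> bool" where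
  "expansion_at_0 \<phi> m \<sigma> \<longleftrightarrow>
     (\<lambda>\<xi>. \<phi> \<xi> - (\<i> * of_real (m * \<xi>) - of_real (\<sigma>\<^sup>2 * \<xi>\<^sup>2 / 2))) \<in> o[at 0](\<lambda>\<xi>. of_real (\<xi>\<^sup>2))"

(* Functions on the torus are 2 pi-periodic functions on the reals; periodicity is implied by
   the pointwise representation as a Fourier series. *)
definition abs_conv_fourier_series :: "(real \<Rightarrow> complex) \<Rightarrow> bool" where
  "abs_conv_fourier_series f \<longleftrightarrow>
     (\<exists>c :: int \<Rightarrow> complex. (\<lambda>k. norm (c k)) summable_on UNIV \<and>
        (\<forall>\<xi>. f \<xi> = (\<Sum>\<^sub>\<infinity>k. c k * exp (\<i> * of_int k * of_real \<xi>))))"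

(* The property of the Fourier transforms shared by the laws (\<mu>\<^sub>n), for which it is mod-phi
   convergence, and by the approximating signed measures (\<nu>\<^sub>n). *)
definition mod_phi ::
  "(real \<Rightarrow> complex) \<Rightarrow> (nat \<Rightarrow> real) \<Rightarrow> (nat \<Rightarrow> int \<Rightarrow> real) \<Rightarrow>
     (nat \<Rightarrow> real \<Rightarrow> complex) \<Rightarrow> (real \<Rightarrow> complex) \<Rightarrow> bool" where
  "mod_phi \<phi> lam \<mu> psi_n psi \<longleftrightarrow>
     filterlim lam at_top sequentially \<and>
     (\<forall>n. abs_conv_fourier_series (psi_n n)) \<and> abs_conv_fourier_series psi \<and>
     (\<forall>n \<xi>. fourier (\<mu> n) \<xi> = exp (of_real (lam n) * \<phi> \<xi>) * psi_n n \<xi>) \<and>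
     uniform_limit UNIV psi_n psi sequentially"

definition approximation_scheme ::
  "(real \<Rightarrow> complex) \<Rightarrow> (nat \<Rightarrow> real) \<Rightarrow> (nat \<Rightarrow> int \<Rightarrow> real) \<Rightarrow>
     (nat \<Rightarrow> real \<Rightarrow> complex) \<Rightarrow> (real \<Rightarrow> complex) \<Rightarrow> bool" where
  "approximation_scheme \<phi> lam \<nu> chi_n chi \<longleftrightarrow>
     (\<forall>n. finite_signed (\<nu> n)) \<and> mod_phi \<phi> lam \<nu> chi_n chi \<and> (\<forall>n. chi_n n 0 = 1) \<and> chi 0 = 1"

definition G :: "nat \<Rightarrow> real \<Rightarrow> real" where
  "G r = (deriv ^^ r) (\<lambda>\<alpha>. exp (- \<alpha>\<^sup>2 / 2))"

primrec hermite :: "nat \<Rightarrow> real poly" where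
  "hermite 0 = 1"
| "hermite (Suc r) = [:0, 1:] * hermite r - pderiv (hermite r)"

lemma G_eq_hermite: "G r \<alpha> = (-1) ^ r * poly (hermite r) \<alpha> * exp (- \<alpha>\<^sup>2 / 2)"
proof (induction r arbitrary: \<alpha>)
  case 0
  show ?case by (simp add: G_def)
next
  case (Suc r)
  have "G (Suc r) \<alpha> = deriv (G r) \<alpha>"
    by (simp add: G_def)
  also have "G r = (\<lambda>x. (-1) ^ r * poly (hermite r) x * exp (- x\<^sup>2 / 2))"
    using Suc.IH by blast
  also have "deriv \<dots> \<alpha> = (-1) ^ Suc r * poly (hermite (Suc r)) \<alpha> * exp (- \<alpha>\<^sup>2 / 2)"
    by (rule DERIV_imp_deriv)
      (auto intro!: derivative_eq_intros poly_DERIV simp: algebra_simps)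
  finally show ?case .
qed

lemma hermite_neq_0: "hermite r \<noteq> 0"
proof -
  have "degree (hermite r) = r \<and> lead_coeff (hermite r) = 1"
  proof (induction r)
    case (Suc r)
    have d: "degree (hermite r) = r" and l: "coeff (hermite r) r = 1"
      using Suc by auto
    have c: "coeff (hermite (Suc r)) (Suc r) = 1"
      using d l by (simp add: coeff_pderiv coeff_eq_0)
    have "degree (hermite (Suc r)) \<le> Suc r"
      using d by (auto intro!: degree_le simp: coeff_pderiv coeff_eq_0 coeff_pCons split: nat.splits)
    with c show ?case
      by (metis le_antisym le_degree one_neq_zero)
  qed auto
  then show ?thesis by fastforce
qed

(* By hermite_neq_0 the set of zeros is finite; it is nonempty for r >= 1. *)
definition smallest_abs_zero :: "nat \<Rightarrow> real" where
  "smallest_abs_zero r = Min (abs ` {x. poly (hermite r) x = 0})"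

end

theory Submission imports Defs "HOL-Real_Asymp.Real_Asymp" begin

text \<open>The masses \<open>\<mu>\<^sub>n {k} - \<nu>\<^sub>n {k}\<close> are the Fourier coefficients of
  \<open>exp (\<lambda>\<^sub>n \<phi>) (\<psi>\<^sub>n - \<chi>\<^sub>n)\<close>. On \<open>[- \<pi>, \<pi>]\<close> one has \<open>Re \<phi> \<xi> \<le> - c \<xi>\<^sup>2\<close> and
  \<open>\<bar>\<psi>\<^sub>n - \<chi>\<^sub>n\<bar> \<le> C \<bar>\<xi>\<bar>\<^bsup>r+1\<^esup>\<close> uniformly in \<open>n\<close>, so after the substitution
  \<open>\<xi> = u / s\<close> with \<open>s = \<sigma> \<surd>\<lambda>\<^sub>n\<close> dominated convergence shows that the rescaled transform tends
  in \<open>L\<^sup>1\<close> to \<open>\<beta> (i u)\<^bsup>r+1\<^esup> exp (- u\<^sup>2 / 2)\<close>, whose Fourier transform is a multiple of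
  \<open>G\<^bsub>r+1\<^esub>\<close>. Hence the rescaled masses are, uniformly in \<open>k\<close>, close to values of
  \<open>G\<^bsub>r+1\<^esub>\<close> on a grid of mesh \<open>1 / s\<close>, and their supremum tends to the maximum of
  \<open>\<bar>G\<^bsub>r+1\<^esub>\<bar>\<close>. That this maximum is attained at the zero of smallest modulus of \<open>H\<^bsub>r+2\<^esub>\<close> follows from
  the monotonicity of the Sonin function.\<close>

section \<open>Extrema of the Hermite functions\<close>

text \<open>The Appell property. Differentiating the defining recurrence leaves
  \<open>hermite (Suc r)\<close> plus r + 1 times the right side of the recurrence one step lower,
  which is \<open>hermite (Suc r)\<close> again. It turns the derivative in the definition into a
  three-term recurrence.\<close>

lemma pderiv_hermite_Suc: "pderiv (hermite (Suc r)) = smult (of_nat (Suc r)) (hermite r)"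
proof (induction r)
  case 0
  show ?case by (simp add: pderiv_pCons)
next
  case (Suc r)
  have "pderiv (hermite (Suc (Suc r)))
      = hermite (Suc r) + [:0, 1:] * pderiv (hermite (Suc r)) - pderiv (pderiv (hermite (Suc r)))"
    by (simp only: hermite.simps(2)[of "Suc r"] pderiv_diff pderiv_mult)
      (simp add: pderiv_pCons algebra_simps)
  also have "\<dots> = hermite (Suc r) + smult (of_nat (Suc r)) (hermite (Suc r))"
    unfolding Suc.IH by (simp add: pderiv_smult smult_diff_right)
  finally show ?case
    by (simp only: of_nat_Suc[of "Suc r"] smult_add_left smult_1_left)
qed

lemma G_0: "G 0 x = exp (- x\<^sup>2 / 2)"
  by (simp add: G_def)

text \<open>As \<open>G (Suc r)\<close> is the derivative of \<open>G r\<close>, this is also the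
  differential equation y'' + x y' + (r + 1) y = 0 for y = \<open>G r\<close>; the arguments on
  zeros and on the maximum use it in that form.\<close>

lemma G_recurrence: "G (Suc (Suc r)) x = - x * G (Suc r) x - real (Suc r) * G r x"
proof -
  have "poly (hermite (Suc (Suc r))) x
      = x * poly (hermite (Suc r)) x - real (Suc r) * poly (hermite r) x"
    by (simp only: hermite.simps(2)[of "Suc r"] pderiv_hermite_Suc) simp
  then show ?thesis
    unfolding G_eq_hermite by (simp only: power_Suc) (simp add: algebra_simps del: hermite.simps)
qed

lemma has_real_derivative_G: "(G r has_real_derivative G (Suc r) x) (at x)"
proof -
  have "(\<lambda>y. (-1) ^ r * poly (hermite r) y * exp (- y\<^sup>2 / 2)) = G r"
    by (simp add: fun_eq_iff G_eq_hermite)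
  moreover have "((\<lambda>y. (-1) ^ r * poly (hermite r) y * exp (- y\<^sup>2 / 2))
      has_real_derivative G (Suc r) x) (at x)"
    by (auto intro!: derivative_eq_intros poly_DERIV simp: algebra_simps G_eq_hermite)
  ultimately show ?thesis by simp
qed

lemma has_real_derivative_G_square:
  "((\<lambda>x. (G r x)\<^sup>2) has_real_derivative 2 * G r x * G (Suc r) x) (at x)"
  using DERIV_power[OF has_real_derivative_G, where n = 2] by (simp add: mult_ac)

lemma continuous_on_G [continuous_intros]: "continuous_on S (G r)"
  using DERIV_isCont[OF has_real_derivative_G] by (auto intro: continuous_at_imp_continuous_on)

lemma G_minus: "G r (- x) = (-1) ^ r * G r x"
proof (induction r rule: induct_nat_012)
  case 0
  show ?case by (simp add: G_0)
next
  case 1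
  show ?case by (simp add: G_eq_hermite)
next
  case (ge2 r)
  then show ?case by (simp add: G_recurrence algebra_simps)
qed

section \<open>Zeros of the Hermite functions and the maximum of their modulus\<close>

lemma G_eq_0_iff: "G r x = 0 \<longleftrightarrow> poly (hermite r) x = 0"
  by (simp add: G_eq_hermite)

text \<open>For odd \<open>r\<close> the function is odd and vanishes at 0. For even
  \<open>r\<close>, suppose it has constant sign: then its antiderivative \<open>G (Suc r)\<close>,
  which vanishes at 0, stays away from 0 beyond 1, and the recurrence drives the function towards 0
  at least linearly, so that it must reach 0 after all.\<close>

lemma ex_zero_G: "\<exists>x. G (Suc (Suc r)) x = 0"
proof (cases "even r")
  case False
  then show ?thesis
    using G_minus[of "Suc (Suc r)" 0] by (intro exI[of _ 0]) simp
next
  case True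
  then have y0: "G (Suc r) 0 = 0"
    using G_minus[of "Suc r" 0] by simp
  show ?thesis
  proof (rule ccontr)
    assume "\<not> ?thesis"
    then have nz: "G (Suc (Suc r)) x \<noteq> 0" for x by blast
    have cont: "continuous_on UNIV (G (Suc (Suc r)))" by (rule continuous_on_G)
    \<comment> \<open>Multiplication by the sign \<open>c\<close> reduces both possible constant
      signs to positivity.\<close>
    define c where "c = sgn (G (Suc (Suc r)) 0)"
    have c0: "c * G (Suc (Suc r)) 0 > 0"
      using nz[of 0] by (auto simp: c_def sgn_if)
    define Y where "Y x = c * G (Suc (Suc r)) x" for x
    have "continuous_on UNIV Y"
      unfolding Y_def[abs_def] using cont by (rule continuous_on_mult_left)
    then have conn: "connected (Y ` UNIV)"
      using connected_UNIV by (rule connected_continuous_image)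
    have "Y x > 0" for x
    proof (rule ccontr)
      assume "\<not> Y x > 0"
      then have "0 \<in> Y ` UNIV"
        using c0 by (intro connectedD_interval[OF conn, of "Y x" "Y 0" 0]) (auto simp: Y_def)
      then show False
        using nz c0 by (auto simp: Y_def)
    qed
    then have pos: "c * G (Suc (Suc r)) x > 0" for x
      by (simp add: Y_def)
    have cy': "((\<lambda>x. c * G n x) has_real_derivative c * G (Suc n) x) (at x)" for n x
      by (rule DERIV_cmult[OF has_real_derivative_G])
    have inc: "c * G (Suc r) a \<le> c * G (Suc r) b" if "a \<le> b" for a b
      using that by (rule DERIV_nonneg_imp_nondecreasing) (use cy' pos in \<open>blast intro: less_imp_le\<close>)
    have "c * G (Suc r) 0 < c * G (Suc r) 1"
      by (rule DERIV_pos_imp_increasing) (use cy' pos in auto)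
    then have y1: "c * G (Suc r) 1 > 0" by (simp add: y0)
    define K where "K = real (Suc (Suc r)) * (c * G (Suc r) 1)"
    have "K > 0" using y1 by (simp add: K_def)
    \<comment> \<open>The line of slope -K through the value at 1 reaches height 0 exactly at
      \<open>b\<close>, and on [1, b] the function lies below that line.\<close>
    define b where "b = 1 + c * G (Suc (Suc r)) 1 / K"
    have Kb: "b * K = K + c * G (Suc (Suc r)) 1" using \<open>K > 0\<close> by (simp add: b_def field_simps)
    have "b > 1" using pos[of 1] \<open>K > 0\<close> by (simp add: b_def)
    have "c * G (Suc (Suc r)) b + K * b \<le> c * G (Suc (Suc r)) 1 + K * 1"
    proof (rule DERIV_nonpos_imp_nonincreasing[where f = "\<lambda>x. c * G (Suc (Suc r)) x + K * x"])
      show "1 \<le> b" using \<open>b > 1\<close> by simp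
    next
      fix x :: real assume x: "1 \<le> x" "x \<le> b"
      have "((\<lambda>x. c * G (Suc (Suc r)) x + K * x) has_real_derivative
          c * G (Suc (Suc (Suc r))) x + K) (at x)"
        using DERIV_add[OF cy' DERIV_cmult_Id] by simp
      moreover have "c * G (Suc (Suc (Suc r))) x
          = - (x * (c * G (Suc (Suc r)) x)) - real (Suc (Suc r)) * (c * G (Suc r) x)"
        unfolding G_recurrence[of "Suc r"] by (simp add: algebra_simps)
      moreover have "x * (c * G (Suc (Suc r)) x) \<ge> 0"
        using pos[of x] x by simp
      moreover have "real (Suc (Suc r)) * (c * G (Suc r) x) \<ge> K"
        unfolding K_def by (intro mult_left_mono inc x) simp
      ultimately show "\<exists>y. ((\<lambda>x. c * G (Suc (Suc r)) x + K * x) has_real_derivative y) (at x) \<and> y \<le> 0"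
        by (intro exI[of _ "c * G (Suc (Suc (Suc r))) x + K"]) linarith
    qed
    then have "c * G (Suc (Suc r)) b \<le> 0"
      using \<open>K > 0\<close> mult.commute[of K b] by (simp add: Kb)
    with pos[of b] show False by simp
  qed
qed

text \<open>\<open>Min\<close> ranges over moduli; that the minimal modulus is itself a zero comes
  from the parity of \<open>G\<close>. The minimum is attained because the zero set is finite and
  nonempty.\<close>

lemma smallest_abs_zero:
  shows smallest_abs_zero_nonneg: "smallest_abs_zero (r + 2) \<ge> 0"
    and G_smallest_abs_zero: "G (r + 2) (smallest_abs_zero (r + 2)) = 0"
    and smallest_abs_zero_le: "G (r + 2) x = 0 \<Longrightarrow> smallest_abs_zero (r + 2) \<le> \<bar>x\<bar>"
proof -
  define Z where "Z = abs ` {x. poly (hermite (r + 2)) x = 0}"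
  have fin: "finite Z"
    unfolding Z_def by (intro finite_imageI poly_roots_finite hermite_neq_0)
  have "Z \<noteq> {}"
    using ex_zero_G[of r] by (auto simp: Z_def G_eq_0_iff simp del: hermite.simps)
  with fin have "smallest_abs_zero (r + 2) \<in> Z"
    unfolding smallest_abs_zero_def Z_def[symmetric] by (rule Min_in)
  then obtain a where a: "G (r + 2) a = 0" "smallest_abs_zero (r + 2) = \<bar>a\<bar>"
    by (auto simp: Z_def G_eq_0_iff simp del: hermite.simps)
  then show "smallest_abs_zero (r + 2) \<ge> 0" "G (r + 2) (smallest_abs_zero (r + 2)) = 0"
    using G_minus[of "r + 2" a] by (auto simp: abs_if)
  show "smallest_abs_zero (r + 2) \<le> \<bar>x\<bar>" if "G (r + 2) x = 0"
    unfolding smallest_abs_zero_def Z_def[symmetric] using fin that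
    by (intro Min_le) (auto simp: Z_def G_eq_0_iff simp del: hermite.simps)
qed

text \<open>The Sonin function \<open>G\<^sub>n\<^sup>2 + G\<^sub>n'\<^sup>2 / (n + 1)\<close> is nonincreasing on the positive half-line,
  because \<open>G\<^sub>n'' + x G\<^sub>n' + (n + 1) G\<^sub>n = 0\<close>; at a critical point it equals \<open>G\<^sub>n\<^sup>2\<close>.\<close>
lemma G_squared_le_critical:
  assumes "0 \<le> z" "z \<le> x" "G (Suc r) z = 0"
  shows "(G r x)\<^sup>2 \<le> (G r z)\<^sup>2"
proof -
  define S where "S x = (G r x)\<^sup>2 + (G (Suc r) x)\<^sup>2 / real (Suc r)" for x
  have "S x \<le> S z"
  proof (rule DERIV_nonpos_imp_nonincreasing[where f = S])
    fix t :: real assume "z \<le> t" "t \<le> x"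
    then have "t \<ge> 0" using assms by simp
    have "(S has_real_derivative
        2 * G r t * G (Suc r) t + 2 * G (Suc r) t * G (Suc (Suc r)) t / real (Suc r)) (at t)"
      unfolding S_def[abs_def]
      by (intro DERIV_add DERIV_cdivide has_real_derivative_G_square)
    also have "2 * G r t * G (Suc r) t + 2 * G (Suc r) t * G (Suc (Suc r)) t / real (Suc r)
        = - (2 * t * (G (Suc r) t)\<^sup>2 / real (Suc r))"
      unfolding G_recurrence by (simp add: field_simps power2_eq_square)
    finally have "(S has_real_derivative - (2 * t * (G (Suc r) t)\<^sup>2 / real (Suc r))) (at t)" .
    moreover have "2 * t * (G (Suc r) t)\<^sup>2 / real (Suc r) \<ge> 0"
      using \<open>t \<ge> 0\<close> by simp
    ultimately show "\<exists>y. (S has_real_derivative y) (at t) \<and> y \<le> 0"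
      by (metis neg_le_0_iff_le)
  qed (fact assms)
  moreover have "(G r x)\<^sup>2 \<le> S x" by (simp add: S_def)
  moreover have "S z = (G r z)\<^sup>2" using assms(3) by (simp add: S_def)
  ultimately show ?thesis by linarith
qed

text \<open>Beyond \<open>z\<close> the Sonin bound applies. Inside [0, z] with \<open>z\<close>
  positive, \<open>r\<close> must be even, since otherwise 0 would be a zero of
  \<open>G (r + 2)\<close>. Then \<open>G (r + 1)\<close> vanishes at 0, and a maximum of its square
  above the value at \<open>z\<close> would be an interior critical point, that is, a zero of
  \<open>G (r + 2)\<close> closer to 0 than \<open>z\<close>. Parity covers negative
  arguments.\<close>

lemma abs_G_le_smallest_abs_zero:
  "\<bar>G (r + 1) x\<bar> \<le> \<bar>G (r + 1) (smallest_abs_zero (r + 2))\<bar>"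
proof -
  define z where "z = smallest_abs_zero (r + 2)"
  have z: "z \<ge> 0" "G (Suc (Suc r)) z = 0" "\<And>x. G (Suc (Suc r)) x = 0 \<Longrightarrow> z \<le> \<bar>x\<bar>"
    using smallest_abs_zero_nonneg[of r] G_smallest_abs_zero[of r] smallest_abs_zero_le[of r]
    by (simp_all add: z_def)
  have "(G (Suc r) x)\<^sup>2 \<le> (G (Suc r) z)\<^sup>2" if "x \<ge> 0" for x
  proof (cases "z \<le> x")
    case True
    then show ?thesis using z by (intro G_squared_le_critical) auto
  next
    case False
    then have "z > 0" using that by simp
    have "even r"
    proof (rule ccontr)
      assume "odd r"
      then have "G (Suc (Suc r)) 0 = 0" using G_minus[of "Suc (Suc r)" 0] by simp
      then show False using z(3)[of 0] \<open>z > 0\<close> by simp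
    qed
    then have y0: "G (Suc r) 0 = 0" using G_minus[of "Suc r" 0] by simp
    have "\<exists>w\<in>{0..z}. \<forall>t\<in>{0..z}. (G (Suc r) t)\<^sup>2 \<le> (G (Suc r) w)\<^sup>2"
      using \<open>z > 0\<close> by (intro continuous_attains_sup continuous_intros) auto
    then obtain w where w: "w \<in> {0..z}" "\<And>t. t \<in> {0..z} \<Longrightarrow> (G (Suc r) t)\<^sup>2 \<le> (G (Suc r) w)\<^sup>2"
      by blast
    show ?thesis
    proof (rule ccontr)
      assume less: "\<not> ?thesis"
      have "(G (Suc r) x)\<^sup>2 \<le> (G (Suc r) w)\<^sup>2" using False that by (intro w) auto
      with less have less': "(G (Suc r) z)\<^sup>2 < (G (Suc r) w)\<^sup>2" by simp
      then have "w \<noteq> z" "G (Suc r) w \<noteq> 0" by auto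
      then have "0 < w" "w < z" using w(1) y0 by (auto simp: order.order_iff_strict)
      have "2 * G (Suc r) w * G (Suc (Suc r)) w = 0"
      proof (rule DERIV_local_max[where d = "min w (z - w)"])
        show "((\<lambda>t. (G (Suc r) t)\<^sup>2) has_real_derivative 2 * G (Suc r) w * G (Suc (Suc r)) w) (at w)"
          by (rule has_real_derivative_G_square)
      qed (use \<open>0 < w\<close> \<open>w < z\<close> in \<open>auto intro!: w(2) simp: abs_if split: if_splits\<close>)
      with \<open>G (Suc r) w \<noteq> 0\<close> have "z \<le> \<bar>w\<bar>" by (intro z(3)) simp
      then show False using \<open>0 < w\<close> \<open>w < z\<close> by simp
    qed
  qed
  from this[of "\<bar>x\<bar>"] have "(G (Suc r) x)\<^sup>2 \<le> (G (Suc r) z)\<^sup>2"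
    using G_minus[of "Suc r" x] by (cases "x \<ge> 0") (simp_all add: power_mult_distrib flip: power_mult)
  then show ?thesis by (simp add: abs_le_square_iff z_def)
qed

section \<open>Fourier transforms of the Hermite functions\<close>

lemma integrable_gauss_moment: "integrable lborel (\<lambda>u::real. \<bar>u\<bar> ^ r * exp (- u\<^sup>2 / 2))"
proof -
  have "integrable lborel (\<lambda>u. sqrt (2 * pi) * (std_normal_density u * \<bar>u\<bar> ^ r))"
    by (intro integrable_mult_right integrable_std_normal_moment_abs)
  then show ?thesis
    by (simp add: std_normal_density_def mult_ac)
qed

text \<open>The Fourier integrand of the Gaussian limit. Under the integral each factor i u acts as
  minus the derivative in \<open>x\<close>, so the integral over \<open>u\<close> is
  \<open>G r x\<close> up to the factor (-1)^r sqrt (2 pi).\<close>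

definition gauss_kernel :: "nat \<Rightarrow> real \<Rightarrow> real \<Rightarrow> complex" where
  "gauss_kernel r x u = exp (- \<i> * of_real (u * x)) * (\<i> * of_real u) ^ r * of_real (exp (- u\<^sup>2 / 2))"

lemma continuous_on_gauss_kernel [continuous_intros]: "continuous_on S (gauss_kernel r x)"
  unfolding gauss_kernel_def[abs_def] by (intro continuous_intros) auto

lemma norm_gauss_kernel: "norm (gauss_kernel r x u) = \<bar>u\<bar> ^ r * exp (- u\<^sup>2 / 2)"
  by (simp add: gauss_kernel_def norm_mult norm_power norm_exp)

lemma integrable_gauss_kernel: "integrable lborel (gauss_kernel r x)"
proof (rule Bochner_Integration.integrable_bound[OF integrable_gauss_moment[of r]])
  show "gauss_kernel r x \<in> borel_measurable lborel"
    using borel_measurable_continuous_onI[OF continuous_on_gauss_kernel] by simp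
qed (simp add: norm_gauss_kernel)

lemma tendsto_gauss_kernel:
  "(gauss_kernel r x \<longlongrightarrow> 0) at_top" "(gauss_kernel r x \<longlongrightarrow> 0) at_bot"
proof -
  have *: "((\<lambda>u::real. \<bar>u\<bar> ^ r * exp (- u\<^sup>2 / 2)) \<longlongrightarrow> 0) at_top"
    by real_asymp
  then show "(gauss_kernel r x \<longlongrightarrow> 0) at_top"
    by (intro tendsto_norm_zero_cancel[where f = "gauss_kernel r x"]) (simp add: norm_gauss_kernel)
  have "((\<lambda>u::real. \<bar>u\<bar> ^ r * exp (- u\<^sup>2 / 2)) \<longlongrightarrow> 0) at_bot"
    using * by (simp add: filterlim_at_bot_mirror)
  then show "(gauss_kernel r x \<longlongrightarrow> 0) at_bot"
    by (intro tendsto_norm_zero_cancel[where f = "gauss_kernel r x"]) (simp add: norm_gauss_kernel)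
qed

text \<open>The derivative is computed for the entire function of a complex variable and then
  restricted to the real line. For \<open>r\<close> = 0 the index \<open>r - 1\<close> is truncated
  to 0, harmlessly, as its coefficient vanishes.\<close>

lemma has_vector_derivative_gauss_kernel:
  "(gauss_kernel r x has_vector_derivative
     (- \<i> * of_real x * gauss_kernel r x u + \<i> * of_nat r * gauss_kernel (r - 1) x u
       + \<i> * gauss_kernel (Suc r) x u)) (at u)"
proof -
  have "((\<lambda>z. exp (- \<i> * (z * of_real x)) * (\<i> * z) ^ r * exp (- z\<^sup>2 / 2)) has_field_derivative
     - \<i> * of_real x * (exp (- \<i> * (of_real u * of_real x)) * (\<i> * of_real u) ^ r * exp (- (of_real u)\<^sup>2 / 2))
     + \<i> * of_nat r * (exp (- \<i> * (of_real u * of_real x)) * (\<i> * of_real u) ^ (r - 1) * exp (- (of_real u)\<^sup>2 / 2))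
     + \<i> * (exp (- \<i> * (of_real u * of_real x)) * (\<i> * of_real u) ^ Suc r * exp (- (of_real u)\<^sup>2 / 2))) (at (of_real u))"
    by (auto intro!: derivative_eq_intros) (simp add: algebra_simps)
  from has_vector_derivative_real_field[OF this] show ?thesis
    unfolding gauss_kernel_def[abs_def] by (simp add: exp_of_real[symmetric])
qed

text \<open>Integrating the derivative of the kernel over the line gives the recurrence of the
  Hermite functions.\<close>
lemma integral_gauss_kernel_recurrence:
  "(\<integral>u. gauss_kernel (Suc r) x u \<partial>lborel)
     = of_real x * (\<integral>u. gauss_kernel r x u \<partial>lborel)
       - of_nat r * (\<integral>u. gauss_kernel (r - 1) x u \<partial>lborel)"
proof -
  let ?f = "\<lambda>u. - \<i> * of_real x * gauss_kernel r x u + \<i> * of_nat r * gauss_kernel (r - 1) x u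
       + \<i> * gauss_kernel (Suc r) x u"
  have int: "integrable lborel ?f"
    by (intro Bochner_Integration.integrable_add integrable_mult_right integrable_gauss_kernel)
  have cont: "continuous_on UNIV ?f"
    by (intro continuous_intros)
  have "(LBINT u=-\<infinity>..\<infinity>. ?f u) = 0 - 0"
  proof (rule interval_integral_FTC_integrable[where F = "gauss_kernel r x"])
    show "isCont ?f u" for u
      using cont by (simp add: continuous_on_eq_continuous_at)
    show "set_integrable lborel (einterval (- \<infinity>) \<infinity>) ?f"
      using int by (simp add: set_integrable_def)
  qed (use has_vector_derivative_gauss_kernel tendsto_gauss_kernel in \<open>auto simp: ereal_tendsto_simps1\<close>)
  then have "(\<integral>u. ?f u \<partial>lborel) = 0"
    by (simp add: interval_lebesgue_integral_def set_lebesgue_integral_def)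
  also have "(\<integral>u. ?f u \<partial>lborel) = - \<i> * of_real x * (\<integral>u. gauss_kernel r x u \<partial>lborel)
      + \<i> * of_nat r * (\<integral>u. gauss_kernel (r - 1) x u \<partial>lborel)
      + \<i> * (\<integral>u. gauss_kernel (Suc r) x u \<partial>lborel)"
    by (simp add: integrable_gauss_kernel)
  finally have "\<i> * (\<integral>u. gauss_kernel (Suc r) x u \<partial>lborel)
     = \<i> * (of_real x * (\<integral>u. gauss_kernel r x u \<partial>lborel)
       - of_nat r * (\<integral>u. gauss_kernel (r - 1) x u \<partial>lborel))"
    by (simp add: algebra_simps add_eq_0_iff)
  then show ?thesis by simp
qed

text \<open>This is the characteristic function of the standard normal law at -x, without the
  normalising constant of the density.\<close>

lemma integral_gauss_kernel_0:
  "(\<integral>u. gauss_kernel 0 x u \<partial>lborel) = of_real (sqrt (2 * pi) * G 0 x)"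
proof -
  have "of_real (exp (- x\<^sup>2 / 2)) = char std_normal_distribution (- x)"
    by (simp add: char_std_normal_distribution)
  also have "\<dots> = (CLINT u | lborel. std_normal_density u *\<^sub>R iexp (- x * u))"
    unfolding char_def by (subst integral_density) (auto simp: normal_density_nonneg)
  also have "\<dots> = (\<integral>u. of_real (1 / sqrt (2 * pi)) * gauss_kernel 0 x u \<partial>lborel)"
    by (intro Bochner_Integration.integral_cong)
      (auto simp: std_normal_density_def gauss_kernel_def scaleR_conv_of_real mult_ac)
  also have "\<dots> = of_real (1 / sqrt (2 * pi)) * (\<integral>u. gauss_kernel 0 x u \<partial>lborel)"
    by (rule integral_mult_right_zero)
  finally show ?thesis
    by (simp add: G_0 field_simps del: real_sqrt_mult)
qed

text \<open>The integrals obey the recurrence of \<open>G\<close> up to alternating signs. Index 1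
  follows from the recurrence at 0, where the term with the truncated index has coefficient
  0.\<close>

lemma integral_gauss_kernel:
  "(\<integral>u. gauss_kernel r x u \<partial>lborel) = of_real (sqrt (2 * pi) * ((-1) ^ r * G r x))"
proof (induction r rule: induct_nat_012)
  case 0
  show ?case by (simp add: integral_gauss_kernel_0)
next
  case 1
  have G1: "G (Suc 0) x = - x * G 0 x" by (simp add: G_eq_hermite)
  show ?case
    using integral_gauss_kernel_recurrence[of 0 x] integral_gauss_kernel_0 by (simp add: G1)
next
  case (ge2 r)
  then show ?case
    using integral_gauss_kernel_recurrence[of "Suc r" x]
    by (simp add: G_recurrence algebra_simps)
qed

section \<open>Fourier series of summable families\<close>

lemma norm_exp_i [simp]: "norm (exp (\<i> * of_int k * of_real x)) = 1"
  by (simp add: norm_exp)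

lemma norm_fourier_term: "norm (complex_of_real a * exp (\<i> * of_int k * of_real \<xi>)) = \<bar>a\<bar>"
  by (simp add: norm_mult)

lemma fourier_has_sum:
  assumes "finite_signed d"
  shows "((\<lambda>k. complex_of_real (d k) * exp (\<i> * of_int k * of_real \<xi>)) has_sum fourier d \<xi>) UNIV"
  unfolding fourier_def
proof (rule has_sum_infsum, rule abs_summable_summable)
  show "(\<lambda>k. norm (complex_of_real (d k) * exp (\<i> * of_int k * of_real \<xi>))) summable_on UNIV"
    using assms by (simp only: norm_fourier_term finite_signed_def)
qed

lemma fourier_diff:
  assumes "finite_signed d" "finite_signed e"
  shows "fourier (\<lambda>k. d k - e k) \<xi> = fourier d \<xi> - fourier e \<xi>"
proof -
  have "((\<lambda>k. complex_of_real (d k) * exp (\<i> * of_int k * of_real \<xi>)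
      + (- 1) * (complex_of_real (e k) * exp (\<i> * of_int k * of_real \<xi>)))
      has_sum fourier d \<xi> + (- 1) * fourier e \<xi>) UNIV"
    by (intro has_sum_add has_sum_cmult_right fourier_has_sum assms)
  then show ?thesis
    unfolding fourier_def[of "\<lambda>k. d k - e k"] by (intro infsumI) (simp add: algebra_simps)
qed

lemma finite_signed_diff:
  assumes "finite_signed d" "finite_signed e"
  shows "finite_signed (\<lambda>k. d k - e k)"
  unfolding finite_signed_def
proof (rule Infinite_Sum.summable_on_comparison_test)
  show "(\<lambda>k. \<bar>d k\<bar> + \<bar>e k\<bar>) summable_on UNIV"
    using assms unfolding finite_signed_def by (rule summable_on_add)
qed auto

lemma finite_signed_measure:
  assumes "finite_measure M" "\<And>k. {k} \<in> sets M"
  shows "finite_signed (\<lambda>k. measure M {k})"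
  unfolding finite_signed_def
proof (rule nonneg_bdd_above_summable_on)
  interpret finite_measure M by fact
  show "bdd_above (sum (\<lambda>k. \<bar>measure M {k}\<bar>) ` {F. F \<subseteq> UNIV \<and> finite F})"
  proof (rule bdd_aboveI2)
    fix F :: "int set" assume "F \<in> {F. F \<subseteq> UNIV \<and> finite F}"
    then have "(\<Sum>k\<in>F. \<bar>measure M {k}\<bar>) = measure M (\<Union>k\<in>F. {k})"
      using assms(2) by (subst finite_measure_finite_Union) (auto simp: disjoint_family_on_def)
    also have "\<dots> \<le> measure M (space M)" by (rule bounded_measure)
    finally show "(\<Sum>k\<in>F. \<bar>measure M {k}\<bar>) \<le> measure M (space M)" .
  qed
qed auto

lemma finite_signed_pmf: "finite_signed (pmf p)"
proof -
  have "finite_measure (measure_pmf p)" by (rule prob_space.finite_measure) (rule prob_space_measure_pmf)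
  from finite_signed_measure[OF this] show ?thesis by (simp add: pmf.rep_eq)
qed

lemma has_integral_exp_int:
  "((\<lambda>\<xi>. exp (\<i> * of_int n * of_real \<xi>)) has_integral (if n = 0 then of_real (2 * pi) else 0)) {-pi..pi}"
proof (cases "n = 0")
  case True
  then show ?thesis
    using has_integral_const_real[of "1::complex" "-pi" pi] by (simp add: scaleR_conv_of_real)
next
  case False
  have "((\<lambda>\<xi>. exp (\<i> * of_int n * of_real \<xi>)) has_integral
     exp (\<i> * of_int n * of_real pi) / (\<i> * of_int n) - exp (\<i> * of_int n * of_real (-pi)) / (\<i> * of_int n)) {-pi..pi}"
  proof (rule fundamental_theorem_of_calculus)
    fix x :: real
    have "((\<lambda>z. exp (\<i> * of_int n * z) / (\<i> * of_int n)) has_field_derivative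
        exp (\<i> * of_int n * of_real x)) (at (of_real x))"
      using False by (auto intro!: derivative_eq_intros)
    from has_vector_derivative_real_field[OF this]
    show "((\<lambda>x. exp (\<i> * of_int n * of_real x) / (\<i> * of_int n)) has_vector_derivative
        exp (\<i> * of_int n * of_real x)) (at x within {-pi..pi})"
      by (rule has_vector_derivative_at_within)
  qed simp
  moreover have "exp (\<i> * of_int n * of_real pi) = exp (\<i> * of_int n * of_real (-pi))"
  proof -
    have "exp (\<i> * of_int n * of_real pi) = exp (\<i> * of_int n * of_real (-pi)) * exp ((2 * of_int n * of_real pi) * \<i>)"
      unfolding exp_add[symmetric] by (rule arg_cong[where f = exp]) (simp add: algebra_simps)
    also have "exp ((2 * of_int n * of_real pi) * \<i>) = 1"
      using exp_integer_2pi[of "of_int n"] by simp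
    finally show ?thesis by (simp only: mult_1_right)
  qed
  ultimately show ?thesis using False by simp
qed

lemma continuous_on_fourier:
  assumes "finite_signed d"
  shows "continuous_on UNIV (fourier d)"
proof (rule uniform_limit_theorem)
  show "uniform_limit UNIV (\<lambda>F \<xi>. \<Sum>k\<in>F. complex_of_real (d k) * exp (\<i> * of_int k * of_real \<xi>))
      (fourier d) (finite_subsets_at_top UNIV)"
    unfolding fourier_def[abs_def] using assms
    by (intro Weierstrass_m_test_general[where M = "\<lambda>k. \<bar>d k\<bar>"])
      (auto simp: norm_mult finite_signed_def)
qed (auto intro!: always_eventually continuous_intros)

text \<open>The series converges uniformly, so integration commutes with the limit over finite index
  sets. By orthogonality the integral of a partial sum already has the final value once its index
  set contains \<open>k\<close>.\<close>

lemma fourier_inversion: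
  assumes "finite_signed d"
  shows "((\<lambda>\<xi>. exp (- \<i> * of_int k * of_real \<xi>) * fourier d \<xi>) has_integral of_real (2 * pi * d k)) {-pi..pi}"
proof -
  let ?t = "\<lambda>j \<xi>. complex_of_real (d j) * exp (\<i> * of_int (j - k) * of_real \<xi>)"
  have "uniform_limit {-pi..pi} (\<lambda>F \<xi>. \<Sum>j\<in>F. ?t j \<xi>)
      (\<lambda>\<xi>. exp (- \<i> * of_int k * of_real \<xi>) * fourier d \<xi>) (finite_subsets_at_top UNIV)"
  proof (rule Weierstrass_m_test_general')
    show "((\<lambda>j. ?t j \<xi>) has_sum exp (- \<i> * of_int k * of_real \<xi>) * fourier d \<xi>) UNIV" for \<xi>
    proof -
      have "(\<lambda>j. ?t j \<xi>) = (\<lambda>j. exp (- \<i> * of_int k * of_real \<xi>) *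
          (complex_of_real (d j) * exp (\<i> * of_int j * of_real \<xi>)))"
      proof
        fix j
        have "exp (\<i> * of_int (j - k) * of_real \<xi>)
            = exp (- \<i> * of_int k * of_real \<xi>) * exp (\<i> * of_int j * complex_of_real \<xi>)"
          by (simp flip: exp_add add: algebra_simps)
        then show "?t j \<xi> = exp (- \<i> * of_int k * of_real \<xi>) *
          (complex_of_real (d j) * exp (\<i> * of_int j * of_real \<xi>))"
          by simp
      qed
      then show ?thesis
        using has_sum_cmult_right[OF fourier_has_sum[OF assms]] by simp
    qed
    show "(\<lambda>j. \<bar>d j\<bar>) summable_on UNIV" using assms by (simp add: finite_signed_def)
    show "norm (?t j \<xi>) \<le> \<bar>d j\<bar>" for j \<xi>
      by (simp only: norm_fourier_term)
  qed
  then obtain I J where I: "\<And>F. ((\<lambda>\<xi>. \<Sum>j\<in>F. ?t j \<xi>) has_integral I F) {-pi..pi}"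
    and J: "((\<lambda>\<xi>. exp (- \<i> * of_int k * of_real \<xi>) * fourier d \<xi>) has_integral J) {-pi..pi}"
    and lim: "(I \<longlongrightarrow> J) (finite_subsets_at_top UNIV)"
  proof (rule uniform_limit_integral)
    show "continuous_on {-pi..pi} (\<lambda>\<xi>. \<Sum>j\<in>F. ?t j \<xi>)" for F
      by (intro continuous_intros)
  qed auto
  have "I F = of_real (2 * pi * d k)" if "finite F" "k \<in> F" for F
  proof (rule has_integral_unique[OF I])
    have "((\<lambda>\<xi>. \<Sum>j\<in>F. ?t j \<xi>) has_integral
        (\<Sum>j\<in>F. of_real (d j) * (if j - k = 0 then of_real (2 * pi) else 0))) {-pi..pi}"
      using that(1) by (intro has_integral_sum has_integral_mult_right has_integral_exp_int)
    also have "(\<Sum>j\<in>F. of_real (d j) * (if j - k = 0 then of_real (2 * pi) else 0))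
        = (\<Sum>j\<in>F. if j = k then complex_of_real (2 * pi * d k) else 0)"
      by (intro sum.cong) auto
    also have "\<dots> = of_real (2 * pi * d k)"
      using that by simp
    finally show "((\<lambda>\<xi>. \<Sum>j\<in>F. ?t j \<xi>) has_integral of_real (2 * pi * d k)) {-pi..pi}" .
  qed
  then have "\<forall>\<^sub>F F in finite_subsets_at_top UNIV. I F = of_real (2 * pi * d k)"
    unfolding eventually_finite_subsets_at_top by (intro exI[of _ "{k}"]) auto
  then have "(I \<longlongrightarrow> of_real (2 * pi * d k)) (finite_subsets_at_top UNIV)"
    by (rule tendsto_eventually)
  with lim have "J = of_real (2 * pi * d k)"
    by (intro tendsto_unique[of "finite_subsets_at_top UNIV" I]) auto
  with J show ?thesis by simp
qed

lemma abs_conv_fourier_series_bounded: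
  assumes "abs_conv_fourier_series f"
  obtains B where "B \<ge> 0" "\<And>\<xi>. norm (f \<xi>) \<le> B"
proof -
  obtain c :: "int \<Rightarrow> complex" where c: "(\<lambda>k. norm (c k)) summable_on UNIV"
    and f: "\<And>\<xi>. f \<xi> = (\<Sum>\<^sub>\<infinity>k. c k * exp (\<i> * of_int k * of_real \<xi>))"
    using assms by (auto simp: abs_conv_fourier_series_def)
  have "norm (f \<xi>) \<le> (\<Sum>\<^sub>\<infinity>k. norm (c k))" for \<xi>
    using norm_infsum_bound[of "\<lambda>k. c k * exp (\<i> * of_int k * of_real \<xi>)" UNIV] c
    by (simp add: f norm_mult)
  moreover have "(\<Sum>\<^sub>\<infinity>k. norm (c k)) \<ge> 0" by (rule infsum_nonneg) simp
  ultimately show thesis using that by blast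
qed

section \<open>The reference law\<close>

text \<open>\<open>nonlattice\<close> excludes subgroups, whereas the arguments below produce
  cosets; infinite divisibility bridges the gap. An atom x of an n-th root puts n x into the
  support, so n x is congruent to \<open>a\<close> modulo \<open>d\<close>, and a suitable n makes
  \<open>a\<close> itself divisible by \<open>d\<close>.\<close>

lemma infinitely_divisible_coset:
  assumes "infinitely_divisible p" and coset: "\<And>k. k \<in> set_pmf p \<Longrightarrow> int d dvd k - a"
  shows "set_pmf p \<subseteq> range (\<lambda>j. int d * j)"
proof -
  \<comment> \<open>For positive \<open>d\<close> the choice n = d makes n x divisible by
    \<open>d\<close>. For \<open>d\<close> = 0 the congruence is the equation a = n x, and n > |a|
    forces a = 0.\<close>
  define n where "n = (if d = 0 then nat \<bar>a\<bar> + 1 else d)"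
  have "n \<ge> 1" by (simp add: n_def)
  then obtain q where q: "p = map_pmf sum_list (replicate_pmf n q)"
    using assms(1) by (auto simp: infinitely_divisible_def)
  obtain x where "x \<in> set_pmf q" using set_pmf_not_empty by fast
  then have "sum_list (replicate n x) \<in> set_pmf p"
    unfolding q set_map_pmf set_replicate_pmf by (intro imageI) (auto simp: lists_eq_set)
  then have "int d dvd int n * x - a"
    by (intro coset) (simp add: sum_list_replicate)
  have "int d dvd a"
  proof (cases "d = 0")
    case True
    then have a: "a = int (nat \<bar>a\<bar> + 1) * x" using \<open>int d dvd int n * x - a\<close> by (simp add: n_def)
    have "a = 0"
    proof (rule ccontr)
      assume "a \<noteq> 0"
      then have "x \<noteq> 0" using a by auto
      then have "\<bar>a\<bar> + 1 \<le> (\<bar>a\<bar> + 1) * \<bar>x\<bar>" by simp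
      also have "\<dots> = \<bar>int (nat \<bar>a\<bar> + 1) * x\<bar>" by (simp add: abs_mult)
      also have "\<dots> = \<bar>a\<bar>" by (simp only: a[symmetric])
      finally show False by simp
    qed
    then show ?thesis by simp
  next
    case False
    then have "int d dvd int d * x - a" using \<open>int d dvd int n * x - a\<close> by (simp add: n_def)
    then show ?thesis by (simp add: dvd_diff_right_iff)
  qed
  show ?thesis
  proof
    fix k assume "k \<in> set_pmf p"
    with coset have "int d dvd k - a" by blast
    with \<open>int d dvd a\<close> have "int d dvd k - a + a" by (rule dvd_add[rotated])
    then show "k \<in> range (\<lambda>j. int d * j)" by auto
  qed
qed

text \<open>Under \<open>p\<close> the numbers exp (i k \<xi>) have mean S, the value of the
  transform, and since they have modulus 1 their variance is 1 - |S|^2. The left side is a single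
  term of that nonnegative sum.\<close>

lemma pmf_deviation_le:
  assumes "fourier (pmf p) 0 = 1"
  shows "pmf p k * (norm (exp (\<i> * of_int k * of_real \<xi>) - fourier (pmf p) \<xi>))\<^sup>2
    \<le> 1 - (norm (fourier (pmf p) \<xi>))\<^sup>2"
proof -
  define S where "S = fourier (pmf p) \<xi>"
  define z where "z k = exp (\<i> * of_int k * complex_of_real \<xi>)" for k :: int
  have one: "(pmf p has_sum 1) UNIV"
    using has_sum_Re[OF fourier_has_sum[OF finite_signed_pmf, of p 0]] assms by simp
  have "((\<lambda>k. cnj S * (complex_of_real (pmf p k) * z k)) has_sum cnj S * S) UNIV"
    unfolding z_def S_def by (intro has_sum_cmult_right fourier_has_sum finite_signed_pmf)
  from has_sum_Re[OF this]
  have cross: "((\<lambda>k. pmf p k * Re (cnj S * z k)) has_sum (norm S)\<^sup>2) UNIV"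
    unfolding cmod_power2 by (simp add: power2_eq_square algebra_simps)
  have "((\<lambda>k. (1 + (norm S)\<^sup>2) * pmf p k + (- 2) * (pmf p k * Re (cnj S * z k)))
      has_sum ((1 + (norm S)\<^sup>2) * 1 + (- 2) * (norm S)\<^sup>2)) UNIV"
    by (intro has_sum_add has_sum_cmult_right one cross)
  moreover have "(1 + (norm S)\<^sup>2) * pmf p k + (- 2) * (pmf p k * Re (cnj S * z k))
      = pmf p k * (norm (z k - S))\<^sup>2" for k
  proof -
    have "(norm (z k))\<^sup>2 = 1" by (simp add: z_def)
    then have *: "(norm (z k - S))\<^sup>2 = 1 + (norm S)\<^sup>2 - 2 * Re (cnj S * z k)"
      unfolding cmod_power2 by (simp add: power2_eq_square algebra_simps)
    show ?thesis unfolding * by (simp add: algebra_simps)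
  qed
  ultimately have sum: "((\<lambda>k. pmf p k * (norm (z k - S))\<^sup>2) has_sum (1 - (norm S)\<^sup>2)) UNIV"
    by simp
  have "pmf p k * (norm (z k - S))\<^sup>2 \<le> 1 - (norm S)\<^sup>2"
  proof (rule has_sum_mono_neutral)
    show "((\<lambda>k. pmf p k * (norm (z k - S))\<^sup>2) has_sum pmf p k * (norm (z k - S))\<^sup>2) {k}"
      by (rule has_sum_finiteI) auto
  qed (use sum in auto)
  then show ?thesis by (simp add: S_def z_def)
qed

lemma norm_exp_i_diff: "norm (exp (\<i> * of_int k * of_real \<xi>) - exp (\<i> * of_int j * of_real \<xi>))
    = norm (exp (\<i> * of_int (k - j) * complex_of_real \<xi>) - 1)"
proof -
  have "exp (\<i> * of_int k * of_real \<xi>) - exp (\<i> * of_int j * of_real \<xi>)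
      = exp (\<i> * of_int j * of_real \<xi>) * (exp (\<i> * of_int (k - j) * complex_of_real \<xi>) - 1)"
    by (simp add: right_diff_distrib flip: exp_add) (simp add: algebra_simps)
  then show ?thesis by (simp only: norm_mult norm_exp_i mult_1_left)
qed

text \<open>The integers \<open>j\<close> with exp (i j \<xi>) = 1 form a subgroup. Its generator is
  \<open>d\<close>, which is 0 if the subgroup is trivial and the least positive element otherwise;
  it is not 1 because 1 is not a member.\<close>

lemma exp_int_eq_1_lattice:
  assumes "exp (\<i> * of_real \<xi>) \<noteq> 1"
  obtains d :: nat where "d \<noteq> 1" "\<And>j. exp (\<i> * of_int j * of_real \<xi>) = 1 \<Longrightarrow> int d dvd j"
proof -
  define H where "H j \<longleftrightarrow> exp (\<i> * of_int j * complex_of_real \<xi>) = 1" for j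
  have H_uminus: "H (- j)" if "H j" for j
    using that by (simp add: H_def exp_minus)
  have H_add: "H (i + j)" if "H i" "H j" for i j
    using that by (simp add: H_def distrib_left distrib_right exp_add)
  have H_mult: "H (int n * j)" if "H j" for n j
  proof (induction n)
    case 0
    show ?case by (simp add: H_def)
  next
    case (Suc n)
    then have "H (j + int n * j)" by (rule H_add[OF that])
    then show ?case by (simp add: distrib_right)
  qed
  show ?thesis
  proof (cases "\<exists>n::nat. n > 0 \<and> H (int n)")
    case False
    have "j = 0" if "H j" for j
      using that H_uminus[OF that] False[unfolded not_ex, rule_format, of "nat \<bar>j\<bar>"]
      by (cases "j \<ge> 0") auto
    then show ?thesis by (intro that[of 0]) (auto simp: H_def)
  next
    case True
    define d where "d = (LEAST n. n > 0 \<and> H (int n))"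
    have d: "d > 0" "H (int d)" and least: "\<And>n. n > 0 \<Longrightarrow> H (int n) \<Longrightarrow> d \<le> n"
      using LeastI_ex[OF True] unfolding d_def[symmetric] by (auto simp: d_def intro: Least_le)
    have "int d dvd j" if "H j" for j
    proof -
      have "H (int (nat \<bar>j div int d\<bar>) * int d)" using d(2) by (rule H_mult)
      then have "H (- (j div int d * int d))"
        using H_uminus by (cases "j div int d \<ge> 0") fastforce+
      with that have "H (j + - (j div int d * int d))" by (rule H_add)
      then have "H (j mod int d)" by (simp add: minus_div_mult_eq_mod)
      moreover have "0 \<le> j mod int d" "j mod int d < int d" using d(1) by auto
      ultimately have "j mod int d = 0"
        using least[of "nat (j mod int d)"] by fastforce
      then show ?thesis by auto
    qed
    moreover have "d \<noteq> 1" using d(2) assms by (auto simp: H_def)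
    ultimately show ?thesis using that by (auto simp: H_def)
  qed
qed

text \<open>Modulus 1 would make the deviation bound zero, so exp (i k \<xi>) would be the same for
  all atoms \<open>k\<close>. The support would then lie in one coset of a proper subgroup, which
  infinite divisibility and \<open>nonlattice\<close> exclude.\<close>

lemma reference_law_norm_fourier_less_1:
  assumes "reference_law p \<phi>" "exp (\<i> * of_real \<xi>) \<noteq> 1"
  shows "norm (fourier (pmf p) \<xi>) < 1"
proof (rule ccontr)
  assume "\<not> ?thesis"
  then have ge: "1 - (norm (fourier (pmf p) \<xi>))\<^sup>2 \<le> 0" by simp
  have 1: "fourier (pmf p) 0 = 1" using assms(1) by (simp add: reference_law_def)
  have eq: "exp (\<i> * of_int k * of_real \<xi>) = fourier (pmf p) \<xi>" if "k \<in> set_pmf p" for k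
  proof -
    have "pmf p k > 0" using that by (simp add: pmf_positive)
    moreover have "pmf p k * (norm (exp (\<i> * of_int k * of_real \<xi>) - fourier (pmf p) \<xi>))\<^sup>2 \<le> 0"
      using pmf_deviation_le[OF 1, of k \<xi>] ge by linarith
    ultimately show ?thesis
      by (simp add: mult_le_0_iff)
  qed
  obtain a where a: "a \<in> set_pmf p" using set_pmf_not_empty by fast
  obtain d :: nat where d: "d \<noteq> 1" "\<And>j. exp (\<i> * of_int j * of_real \<xi>) = 1 \<Longrightarrow> int d dvd j"
    using exp_int_eq_1_lattice[OF assms(2)] by blast
  have "set_pmf p \<subseteq> range (\<lambda>j. int d * j)"
  proof (rule infinitely_divisible_coset)
    show "infinitely_divisible p" using assms(1) by (simp add: reference_law_def)
    fix k assume "k \<in> set_pmf p"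
    with eq a have "exp (\<i> * of_int k * of_real \<xi>) - exp (\<i> * of_int a * of_real \<xi>) = 0"
      by simp
    then have "norm (exp (\<i> * of_int (k - a) * complex_of_real \<xi>) - 1) = 0"
      unfolding norm_exp_i_diff[symmetric] by simp
    then show "int d dvd k - a" by (intro d(2)) simp
  qed
  with d(1) assms(1) show False by (auto simp: reference_law_def nonlattice_def)
qed

text \<open>If \<sigma> were 0, the real part of \<phi> would be o(\<xi>^2), and by the deviation
  bound exp (i k \<xi>) would differ from the transform by o(\<xi>) for every atom \<open>k\<close>.
  Comparing two atoms shows that they coincide, so the law is a point mass, and infinite
  divisibility forces it to sit at 0, against \<open>nonlattice\<close>.\<close>

lemma reference_law_sigma_nonzero:
  assumes "reference_law p \<phi>" "expansion_at_0 \<phi> m \<sigma>"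
  shows "\<sigma> \<noteq> 0"
proof
  assume "\<sigma> = 0"
  define S where "S = fourier (pmf p)"
  have S: "S \<xi> = exp (\<phi> \<xi>)" for \<xi> using assms(1) by (simp add: S_def reference_law_def)
  have "((\<lambda>\<xi>. (\<phi> \<xi> - \<i> * of_real (m * \<xi>)) / of_real (\<xi>\<^sup>2)) \<longlongrightarrow> 0) (at 0)"
    using assms(2) \<open>\<sigma> = 0\<close> by (auto simp: expansion_at_0_def dest!: smalloD_tendsto)
  from tendsto_Re[OF this] have Re0: "((\<lambda>\<xi>. Re (\<phi> \<xi>) / \<xi>\<^sup>2) \<longlongrightarrow> 0) (at 0)"
    by (simp add: Re_divide_of_real del: of_real_power)
  have dev: "((\<lambda>\<xi>. norm (exp (\<i> * of_int k * of_real \<xi>) - S \<xi>) / \<bar>\<xi>\<bar>) \<longlongrightarrow> 0) (at 0)"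
    if "k \<in> set_pmf p" for k
  proof -
    have pos: "pmf p k > 0" using that by (simp add: pmf_positive)
    have "((\<lambda>\<xi>. (norm (exp (\<i> * of_int k * of_real \<xi>) - S \<xi>) / \<bar>\<xi>\<bar>)\<^sup>2) \<longlongrightarrow> 0) (at 0)"
    proof (rule tendsto_sandwich[OF _ _ tendsto_const])
      show "((\<lambda>\<xi>. - 2 / pmf p k * (Re (\<phi> \<xi>) / \<xi>\<^sup>2)) \<longlongrightarrow> 0) (at 0)"
        by (rule tendsto_mult_right_zero[OF Re0])
      have "(norm (exp (\<i> * of_int k * of_real \<xi>) - S \<xi>) / \<bar>\<xi>\<bar>)\<^sup>2
          \<le> - 2 / pmf p k * (Re (\<phi> \<xi>) / \<xi>\<^sup>2)" for \<xi>
      proof -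
        have "pmf p k * (norm (exp (\<i> * of_int k * of_real \<xi>) - S \<xi>))\<^sup>2 \<le> 1 - (norm (S \<xi>))\<^sup>2"
          unfolding S_def using assms(1) by (intro pmf_deviation_le) (simp add: reference_law_def)
        also have "(norm (S \<xi>))\<^sup>2 = exp (2 * Re (\<phi> \<xi>))"
          by (simp add: S exp_double)
        also have "1 - exp (2 * Re (\<phi> \<xi>)) \<le> - 2 * Re (\<phi> \<xi>)"
          using exp_ge_add_one_self[of "2 * Re (\<phi> \<xi>)"] by linarith
        finally have "(norm (exp (\<i> * of_int k * of_real \<xi>) - S \<xi>))\<^sup>2 \<le> - 2 / pmf p k * Re (\<phi> \<xi>)"
          using pos by (simp add: field_simps)
        then have "(norm (exp (\<i> * of_int k * of_real \<xi>) - S \<xi>))\<^sup>2 / \<xi>\<^sup>2 \<le> - 2 / pmf p k * Re (\<phi> \<xi>) / \<xi>\<^sup>2"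
          by (rule divide_right_mono) simp
        then show ?thesis by (simp add: power_divide)
      qed
      then show "\<forall>\<^sub>F \<xi> in at 0. (norm (exp (\<i> * of_int k * of_real \<xi>) - S \<xi>) / \<bar>\<xi>\<bar>)\<^sup>2
          \<le> - 2 / pmf p k * (Re (\<phi> \<xi>) / \<xi>\<^sup>2)" by simp
    qed simp
    from tendsto_real_sqrt[OF this] show ?thesis by simp
  qed
  obtain a where a: "a \<in> set_pmf p" using set_pmf_not_empty by fast
  have single: "k = a" if "k \<in> set_pmf p" for k
  proof -
    have "((\<lambda>\<xi>. norm (exp (\<i> * of_int (k - a) * of_real \<xi>) - 1) / \<bar>\<xi>\<bar>) \<longlongrightarrow> 0) (at 0)"
    proof (rule tendsto_sandwich[OF _ _ tendsto_const])
      show "((\<lambda>\<xi>. norm (exp (\<i> * of_int k * of_real \<xi>) - S \<xi>) / \<bar>\<xi>\<bar>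
          + norm (exp (\<i> * of_int a * of_real \<xi>) - S \<xi>) / \<bar>\<xi>\<bar>) \<longlongrightarrow> 0) (at 0)"
        using tendsto_add[OF dev[OF that] dev[OF a]] by simp
      have "norm (exp (\<i> * of_int (k - a) * of_real \<xi>) - 1) / \<bar>\<xi>\<bar>
          \<le> norm (exp (\<i> * of_int k * of_real \<xi>) - S \<xi>) / \<bar>\<xi>\<bar>
          + norm (exp (\<i> * of_int a * of_real \<xi>) - S \<xi>) / \<bar>\<xi>\<bar>" for \<xi>
        unfolding norm_exp_i_diff[symmetric] add_divide_distrib[symmetric]
        by (intro divide_right_mono norm_diff_triangle_le[OF order.refl eq_refl] norm_minus_commute) simp
      then show "\<forall>\<^sub>F \<xi> in at 0. norm (exp (\<i> * of_int (k - a) * of_real \<xi>) - 1) / \<bar>\<xi>\<bar>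
          \<le> norm (exp (\<i> * of_int k * of_real \<xi>) - S \<xi>) / \<bar>\<xi>\<bar>
          + norm (exp (\<i> * of_int a * of_real \<xi>) - S \<xi>) / \<bar>\<xi>\<bar>" by simp
    qed simp
    \<comment> \<open>The same expression is the modulus of a difference quotient of the exponential
      at 0, so its limit is |k - a|.\<close>
    moreover have "((\<lambda>\<xi>. norm (exp (\<i> * of_int (k - a) * of_real \<xi>) - 1) / \<bar>\<xi>\<bar>)
        \<longlongrightarrow> norm (\<i> * of_int (k - a) :: complex)) (at (0::real))"
    proof -
      have "((\<lambda>z. exp (\<i> * of_int (k - a) * z)) has_field_derivative \<i> * of_int (k - a)) (at (of_real 0))"
        by (auto intro!: derivative_eq_intros)
      then have "((\<lambda>z. (exp (\<i> * of_int (k - a) * z) - 1) / z) \<longlongrightarrow> \<i> * of_int (k - a)) (at 0)"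
        by (simp add: has_field_derivative_iff)
      moreover have "filterlim (of_real :: real \<Rightarrow> complex) (at 0) (at 0)"
        by (intro filterlim_atI) (auto intro!: tendsto_eq_intros simp: eventually_at_filter)
      ultimately have "((\<lambda>\<xi>. (exp (\<i> * of_int (k - a) * of_real \<xi>) - 1) / of_real \<xi>) \<longlongrightarrow> \<i> * of_int (k - a)) (at (0::real))"
        by (rule filterlim_compose)
      from tendsto_norm[OF this] show ?thesis by (simp add: norm_divide)
    qed
    ultimately have "norm (\<i> * of_int (k - a) :: complex) = 0"
      by (intro tendsto_unique[OF at_neq_bot]) auto
    then show ?thesis by (simp add: norm_mult)
  qed
  \<comment> \<open>Divisibility by 0 means equality, so the coset lemma with \<open>d\<close> = 0
    applies to the single atom \<open>a\<close>.\<close>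
  have "set_pmf p \<subseteq> range (\<lambda>j. int 0 * j)"
    using assms(1) single by (intro infinitely_divisible_coset[where a = a]) (auto simp: reference_law_def)
  with assms(1) show False
    unfolding reference_law_def nonlattice_def by (metis zero_neq_one)
qed

text \<open>Near 0 the bound comes from the quadratic expansion, on the rest of [-pi, pi] from
  compactness and the strict inequality for the modulus of the transform; \<open>c\<close> is the
  smaller of the two constants.\<close>

lemma reference_law_Re_le:
  assumes "reference_law p \<phi>" "expansion_at_0 \<phi> m \<sigma>"
  obtains c where "c > 0" "\<And>\<xi>. \<bar>\<xi>\<bar> \<le> pi \<Longrightarrow> Re (\<phi> \<xi>) \<le> - c * \<xi>\<^sup>2"
proof -
  have "\<sigma> \<noteq> 0" by (rule reference_law_sigma_nonzero[OF assms])
  \<comment> \<open>An error of \<sigma>^2 \<xi>^2 / 4 consumes only half of the quadratic term and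
    leaves the rate \<sigma>^2 / 4.\<close>
  have "\<forall>\<^sub>F \<xi> in at 0. norm (\<phi> \<xi> - (\<i> * of_real (m * \<xi>) - of_real (\<sigma>\<^sup>2 * \<xi>\<^sup>2 / 2)))
      \<le> \<sigma>\<^sup>2 / 4 * norm (complex_of_real (\<xi>\<^sup>2))"
    using assms(2) \<open>\<sigma> \<noteq> 0\<close> unfolding expansion_at_0_def by (intro landau_o.smallD) auto
  then obtain \<delta> where \<delta>: "\<delta> > 0" and near: "\<And>\<xi>. \<xi> \<noteq> 0 \<Longrightarrow> \<bar>\<xi>\<bar> < \<delta> \<Longrightarrow>
      norm (\<phi> \<xi> - (\<i> * of_real (m * \<xi>) - of_real (\<sigma>\<^sup>2 * \<xi>\<^sup>2 / 2))) \<le> \<sigma>\<^sup>2 / 4 * \<xi>\<^sup>2"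
    by (auto simp: eventually_at dist_real_def norm_power)
  have near': "Re (\<phi> \<xi>) \<le> - (\<sigma>\<^sup>2 / 4) * \<xi>\<^sup>2" if "\<bar>\<xi>\<bar> < \<delta>" for \<xi>
  proof (cases "\<xi> = 0")
    case True
    then show ?thesis using assms(1) by (simp add: reference_law_def)
  next
    case False
    have "Re (\<phi> \<xi> - (\<i> * of_real (m * \<xi>) - of_real (\<sigma>\<^sup>2 * \<xi>\<^sup>2 / 2))) \<le> \<sigma>\<^sup>2 / 4 * \<xi>\<^sup>2"
      using near[OF False that] complex_Re_le_cmod order_trans by blast
    then show ?thesis by simp
  qed
  define K where "K = {\<xi>::real. \<delta> \<le> \<bar>\<xi>\<bar> \<and> \<bar>\<xi>\<bar> \<le> pi}"
  have "K = {-pi..pi} \<inter> {\<xi>. \<delta> \<le> \<bar>\<xi>\<bar>}" by (auto simp: K_def)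
  then have "compact K"
    by (auto intro!: compact_Int_closed closed_Collect_le continuous_intros)
  have neg: "Re (\<phi> \<xi>) < 0" if "\<xi> \<in> K" for \<xi>
  proof -
    have "exp (\<i> * of_real \<xi>) \<noteq> 1"
    proof
      assume "exp (\<i> * of_real \<xi>) = 1"
      then obtain j :: int where j: "\<xi> = of_int (2 * j) * pi" by (auto simp: exp_eq_1)
      then have "\<bar>of_int (2 * j)\<bar> * pi \<le> 1 * pi" using that by (simp add: K_def abs_mult)
      then have "\<bar>real_of_int (2 * j)\<bar> \<le> 1" by (rule mult_right_le_imp_le) simp
      then have "j = 0" by linarith
      then show False using j that \<delta> by (simp add: K_def)
    qed
    from reference_law_norm_fourier_less_1[OF assms(1) this] show ?thesis
      using assms(1) by (simp add: reference_law_def)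
  qed
  obtain \<eta> where \<eta>: "\<eta> > 0" "\<And>\<xi>. \<xi> \<in> K \<Longrightarrow> Re (\<phi> \<xi>) \<le> - \<eta>"
  proof (cases "K = {}")
    case True
    then show ?thesis using that[of 1] by simp
  next
    case False
    have "continuous_on K (\<lambda>\<xi>. Re (\<phi> \<xi>))"
      using assms(1) unfolding reference_law_def
      by (intro continuous_on_Re) (auto intro: continuous_on_subset)
    from continuous_attains_sup[OF \<open>compact K\<close> False this] obtain w
      where "w \<in> K" "\<And>\<xi>. \<xi> \<in> K \<Longrightarrow> Re (\<phi> \<xi>) \<le> Re (\<phi> w)" by blast
    then show ?thesis using that[of "- Re (\<phi> w)"] neg by simp
  qed
  show ?thesis
  \<comment> \<open>Division of \<eta> by pi^2 turns the constant bound into a quadratic one, as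
    \<xi>^2 is at most pi^2.\<close>
  proof (rule that[of "min (\<sigma>\<^sup>2 / 4) (\<eta> / pi\<^sup>2)"])
    show "min (\<sigma>\<^sup>2 / 4) (\<eta> / pi\<^sup>2) > 0" using \<open>\<sigma> \<noteq> 0\<close> \<eta>(1) by simp
    fix \<xi> :: real assume \<xi>: "\<bar>\<xi>\<bar> \<le> pi"
    show "Re (\<phi> \<xi>) \<le> - min (\<sigma>\<^sup>2 / 4) (\<eta> / pi\<^sup>2) * \<xi>\<^sup>2"
    proof (cases "\<bar>\<xi>\<bar> < \<delta>")
      case True
      have "min (\<sigma>\<^sup>2 / 4) (\<eta> / pi\<^sup>2) * \<xi>\<^sup>2 \<le> \<sigma>\<^sup>2 / 4 * \<xi>\<^sup>2"
        by (rule mult_right_mono[OF min.cobounded1]) simp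
      then show ?thesis using near'[OF True] unfolding mult_minus_left by linarith
    next
      case False
      have "min (\<sigma>\<^sup>2 / 4) (\<eta> / pi\<^sup>2) * \<xi>\<^sup>2 \<le> \<eta> / pi\<^sup>2 * pi\<^sup>2"
        using \<xi> \<eta>(1) power_mono[OF \<xi>, of 2] by (intro mult_mono) auto
      also have "\<dots> = \<eta>" by simp
      finally show ?thesis using \<eta>(2)[of \<xi>] False \<xi> by (simp add: K_def)
    qed
  qed
qed

section \<open>The Gaussian limit\<close>

lemma integrable_gauss_moment_scaled:
  assumes "a > 0"
  shows "integrable lborel (\<lambda>u::real. \<bar>u\<bar> ^ r * exp (- a * u\<^sup>2))"
proof -
  define k where "k = sqrt (2 * a)"
  have k: "k > 0" "k\<^sup>2 = 2 * a" using assms by (simp_all add: k_def)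
  have "integrable lborel (\<lambda>u. \<bar>0 + k * u\<bar> ^ r * exp (- (0 + k * u)\<^sup>2 / 2))"
    using integrable_gauss_moment k(1) by (intro lborel_integrable_real_affine) auto
  then have "integrable lborel (\<lambda>u. (1 / k ^ r) * (\<bar>0 + k * u\<bar> ^ r * exp (- (0 + k * u)\<^sup>2 / 2)))"
    by (rule integrable_mult_right)
  then show ?thesis
    using k by (simp add: abs_mult power_mult_distrib)
qed

text \<open>One period of the transform in the variable u = s \<xi>: the cutoff extends it by 0 to
  the line, the phase with \<open>x\<close> recentres the law, and s^q compensates the order
  \<open>q\<close> to which \<open>F\<close> vanishes at 0.\<close>

definition scaled_transform :: "nat \<Rightarrow> real \<Rightarrow> real \<Rightarrow> (real \<Rightarrow> complex) \<Rightarrow> real \<Rightarrow> complex" where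
  "scaled_transform q s x F u = indicator {- pi..pi} (u / s) *\<^sub>R
     (of_real (s ^ q) * exp (\<i> * of_real (- u * x)) * F (u / s))"

lemma borel_measurable_scaled_transform:
  assumes "continuous_on UNIV F"
  shows "scaled_transform q s x F \<in> borel_measurable borel"
proof -
  have [measurable]: "F \<in> borel_measurable borel"
    by (rule borel_measurable_continuous_onI[OF assms])
  have [measurable]: "(\<lambda>u::real. exp (\<i> * of_real (- u * x))) \<in> borel_measurable borel"
    by (intro borel_measurable_continuous_onI continuous_intros)
  show ?thesis unfolding scaled_transform_def[abs_def] by measurable
qed

text \<open>Fourier inversion with \<xi> = u / s; the Jacobian accounts for the additional power of
  \<open>s\<close>. The shift \<open>x\<close> is arbitrary, as the two phases combine to exp (- i k
  u / s).\<close>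

lemma local_mass_eq_integral_scaled_transform:
  assumes "finite_signed d" "s > 0"
  shows "of_real (2 * pi * s ^ Suc q * d k)
    = (\<integral>u. exp (\<i> * of_real (- u * (of_int k / s - x))) * scaled_transform q s x (fourier d) u \<partial>lborel)"
proof -
  let ?h = "\<lambda>\<xi>. exp (- \<i> * of_int k * of_real \<xi>) * fourier d \<xi>"
  have cont: "continuous_on S (fourier d)" for S
    using continuous_on_fourier[OF assms(1)] by (rule continuous_on_subset) simp
  have "set_integrable lborel {-pi..pi} ?h"
    by (intro borel_integrable_atLeastAtMost' continuous_intros cont)
  from set_borel_integral_eq_integral(2)[OF this]
  have "of_real (2 * pi * d k) = (\<integral>\<xi>. indicator {-pi..pi} \<xi> *\<^sub>R ?h \<xi> \<partial>lborel)"
    using integral_unique[OF fourier_inversion[OF assms(1), of k]]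
    by (simp add: set_lebesgue_integral_def)
  also have "\<dots> = \<bar>1 / s\<bar> *\<^sub>R (\<integral>u. indicator {-pi..pi} (0 + 1 / s * u) *\<^sub>R ?h (0 + 1 / s * u) \<partial>lborel)"
    using assms(2) by (intro lborel_integral_real_affine) simp
  finally have "of_real (s ^ Suc q) * complex_of_real (2 * pi * d k)
      = of_real (s ^ q) * (\<integral>u. indicator {-pi..pi} (u / s) *\<^sub>R ?h (u / s) \<partial>lborel)"
    using assms(2) by (simp add: scaleR_conv_of_real)
  also have "\<dots> = (\<integral>u. of_real (s ^ q) * (indicator {-pi..pi} (u / s) *\<^sub>R ?h (u / s)) \<partial>lborel)"
    by (rule integral_mult_right_zero[symmetric])
  also have "\<dots> = (\<integral>u. exp (\<i> * of_real (- u * (of_int k / s - x))) * scaled_transform q s x (fourier d) u \<partial>lborel)"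
  proof (rule Bochner_Integration.integral_cong[OF refl])
    fix u
    have "exp (- \<i> * of_int k * of_real (u / s))
        = exp (\<i> * of_real (- u * (of_int k / s - x))) * exp (\<i> * complex_of_real (- u * x))"
      unfolding exp_add[symmetric] by (rule arg_cong[where f = exp]) (simp add: algebra_simps)
    then show "of_real (s ^ q) * (indicator {-pi..pi} (u / s) *\<^sub>R ?h (u / s))
        = exp (\<i> * of_real (- u * (of_int k / s - x))) * scaled_transform q s x (fourier d) u"
      by (simp only: scaled_transform_def scaleR_conv_of_real mult_ac)
  qed
  finally show ?thesis by (simp add: mult_ac)
qed

text \<open>Dominated convergence: with \<xi> = u / s the bound becomes C |u|^q exp (- a u^2), which
  is free of \<open>n\<close>. The point u = 0, about which \<open>bound\<close> and
  \<open>lim\<close> say nothing, is a null set.\<close>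

lemma scaled_transform_L1_limit:
  fixes F :: "nat \<Rightarrow> real \<Rightarrow> complex" and s x :: "nat \<Rightarrow> real" and a C :: real and \<beta> :: complex
  assumes s: "filterlim s at_top sequentially"
    and cont: "\<And>n. continuous_on UNIV (F n)"
    and a: "a > 0"
    and bound: "\<forall>\<^sub>F n in sequentially. \<forall>\<xi>. \<xi> \<noteq> 0 \<longrightarrow> \<bar>\<xi>\<bar> \<le> pi \<longrightarrow>
        norm (F n \<xi>) \<le> C * \<bar>\<xi>\<bar> ^ q * exp (- a * (s n)\<^sup>2 * \<xi>\<^sup>2)"
    and lim: "\<And>u. u \<noteq> 0 \<Longrightarrow> (\<lambda>n. of_real (s n ^ q) * exp (\<i> * of_real (- u * x n)) * F n (u / s n))
        \<longlonglongrightarrow> \<beta> * gauss_kernel q 0 u"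
  shows "(\<lambda>n. \<integral>u. norm (scaled_transform q (s n) (x n) (F n) u - \<beta> * gauss_kernel q 0 u) \<partial>lborel) \<longlonglongrightarrow> 0"
    and "\<forall>\<^sub>F n in sequentially. integrable lborel (scaled_transform q (s n) (x n) (F n))"
proof -
  let ?g = "\<lambda>n. scaled_transform q (s n) (x n) (F n)"
  let ?w = "\<lambda>u::real. C * (\<bar>u\<bar> ^ q * exp (- a * u\<^sup>2))"
  have meas: "?g n \<in> borel_measurable lborel" for n
    using borel_measurable_scaled_transform[OF cont] by simp
  have int_w: "integrable lborel ?w"
    by (intro integrable_mult_right integrable_gauss_moment_scaled a)
  have spos: "\<forall>\<^sub>F n in sequentially. s n > 0"
    using s by (simp add: filterlim_at_top_dense)
  have le_w: "\<forall>\<^sub>F n in sequentially. \<forall>u. u \<noteq> 0 \<longrightarrow> norm (?g n u) \<le> ?w u"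
    using bound spos
  proof eventually_elim
    case (elim n)
    show ?case
    proof (intro allI impI)
      fix u :: real assume "u \<noteq> 0"
      show "norm (?g n u) \<le> ?w u"
      proof (cases "u / s n \<in> {-pi..pi}")
        case True
        then have "\<bar>u / s n\<bar> \<le> pi" by auto
        then have "norm (F n (u / s n)) \<le> C * \<bar>u / s n\<bar> ^ q * exp (- a * (s n)\<^sup>2 * (u / s n)\<^sup>2)"
          using elim(2) \<open>u \<noteq> 0\<close> by (intro elim(1)[rule_format]) auto
        also have "\<bar>u / s n\<bar> ^ q = \<bar>u\<bar> ^ q / s n ^ q"
          using elim(2) by (simp add: power_divide)
        also have "- a * (s n)\<^sup>2 * (u / s n)\<^sup>2 = - a * u\<^sup>2"
          using elim(2) by (simp add: power_divide)
        finally have "s n ^ q * norm (F n (u / s n)) \<le> s n ^ q * (C * (\<bar>u\<bar> ^ q / s n ^ q) * exp (- a * u\<^sup>2))"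
          using elim(2) by (intro mult_left_mono) auto
        also have "\<dots> = ?w u" using elim(2) by simp
        finally show ?thesis
          using True elim(2) by (simp add: scaled_transform_def norm_mult norm_power norm_exp)
      next
        case False
        \<comment> \<open>Outside the cutoff the transform is 0 and the majorant only has to be
          nonnegative; the bound at the sample point pi / 2 shows that \<open>C\<close> is.\<close>
        have "norm (F n (pi / 2)) \<le> C * \<bar>pi / 2\<bar> ^ q * exp (- a * (s n)\<^sup>2 * (pi / 2)\<^sup>2)"
          by (rule elim(1)[rule_format]) auto
        from order_trans[OF norm_ge_zero this] have "C \<ge> 0"
          by (simp add: zero_le_mult_iff power_le_zero_eq pi_gt_zero[unfolded less_le_not_le])
        then show ?thesis using False by (simp add: scaled_transform_def)
      qed
    qed
  qed
  have AE_0: "AE u in lborel. u \<noteq> (0::real)" by (rule AE_lborel_singleton)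
  show ev_int: "\<forall>\<^sub>F n in sequentially. integrable lborel (?g n)"
    using le_w
  proof eventually_elim
    case (elim n)
    show ?case
      by (rule Bochner_Integration.integrable_bound[OF int_w meas])
        (use AE_0 in eventually_elim, use elim in fastforce)
  qed
  have int_k: "integrable lborel (\<lambda>u. norm (\<beta> * gauss_kernel q 0 u))"
    by (intro integrable_norm integrable_mult_right integrable_gauss_kernel)
  obtain N where N: "\<And>n u. n \<ge> N \<Longrightarrow> u \<noteq> 0 \<Longrightarrow> norm (?g n u) \<le> ?w u"
    using le_w by (auto simp: eventually_sequentially)
  \<comment> \<open>The majorant is available from \<open>N\<close> on, hence the shifted
    sequence.\<close>
  have "(\<lambda>n. \<integral>u. norm (?g (n + N) u - \<beta> * gauss_kernel q 0 u) \<partial>lborel) \<longlonglongrightarrow> (\<integral>u. 0 \<partial>(lborel :: real measure))"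
  proof (rule integral_dominated_convergence[where w = "\<lambda>u. ?w u + norm (\<beta> * gauss_kernel q 0 u)"])
    show "integrable lborel (\<lambda>u. ?w u + norm (\<beta> * gauss_kernel q 0 u))"
      by (intro Bochner_Integration.integrable_add int_w int_k)
    show "(\<lambda>u. norm (?g (n + N) u - \<beta> * gauss_kernel q 0 u)) \<in> borel_measurable lborel" for n
    proof -
      note [measurable] = meas[of "n + N"] borel_measurable_integrable[OF integrable_gauss_kernel[of q 0]]
      show ?thesis by measurable
    qed
    show "AE u in lborel. norm (norm (?g (n + N) u - \<beta> * gauss_kernel q 0 u))
        \<le> ?w u + norm (\<beta> * gauss_kernel q 0 u)" for n
      using AE_0
    proof eventually_elim
      case (elim u)
      have "norm (?g (n + N) u - \<beta> * gauss_kernel q 0 u)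
          \<le> norm (?g (n + N) u) + norm (\<beta> * gauss_kernel q 0 u)"
        by (rule norm_triangle_ineq4)
      then show ?case using N[of "n + N" u] elim by simp
    qed
    show "AE u in lborel. (\<lambda>n. norm (?g (n + N) u - \<beta> * gauss_kernel q 0 u)) \<longlonglongrightarrow> 0"
      using AE_0
    proof eventually_elim
      case (elim u)
      \<comment> \<open>For fixed \<open>u\<close> the cutoff is inactive as soon as |u| / s is at
        most pi.\<close>
      have "\<forall>\<^sub>F n in sequentially. s n \<ge> \<bar>u\<bar> / pi"
        using s by (simp add: filterlim_at_top)
      then have "\<forall>\<^sub>F n in sequentially. of_real (s n ^ q) * exp (\<i> * of_real (- u * x n)) * F n (u / s n) = ?g n u"
        using spos
      proof eventually_elim
        case (elim n)
        then have "\<bar>u\<bar> \<le> pi * s n" by (simp add: field_simps)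
        then have "u / s n \<in> {-pi..pi}" using elim by (auto simp: field_simps abs_le_iff)
        then show ?case by (simp add: scaled_transform_def)
      qed
      then have "(\<lambda>n. ?g n u) \<longlonglongrightarrow> \<beta> * gauss_kernel q 0 u"
        by (rule Lim_transform_eventually[OF lim[OF elim]])
      then have "(\<lambda>n. ?g (n + N) u) \<longlonglongrightarrow> \<beta> * gauss_kernel q 0 u"
        by (rule LIMSEQ_ignore_initial_segment)
      then show ?case
        by (intro tendsto_norm_zero) (simp add: LIM_zero)
    qed
  qed simp
  then show "(\<lambda>n. \<integral>u. norm (?g n u - \<beta> * gauss_kernel q 0 u) \<partial>lborel) \<longlonglongrightarrow> 0"
    unfolding integral_zero by (rule LIMSEQ_offset)
qed

text \<open>The factor exp (- i u y) has modulus 1, so a single L1 error \<open>e n\<close> controls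
  the masses at all \<open>k\<close> at once. The maximum of |G q| bounds the supremum from above;
  from below it suffices to test one \<open>k\<close> whose grid point is close to
  \<open>z\<close>.\<close>

lemma local_dist_limit:
  fixes d :: "nat \<Rightarrow> int \<Rightarrow> real"
  assumes s: "filterlim s at_top sequentially"
    and fin: "\<And>n. finite_signed (d n)"
    and int: "\<forall>\<^sub>F n in sequentially. integrable lborel (scaled_transform q (s n) (x n) (fourier (d n)))"
    and L1: "(\<lambda>n. \<integral>u. norm (scaled_transform q (s n) (x n) (fourier (d n)) u
        - \<beta> * gauss_kernel q 0 u) \<partial>lborel) \<longlonglongrightarrow> 0"
    and max: "\<And>y. \<bar>G q y\<bar> \<le> \<bar>G q z\<bar>"
  shows "(\<lambda>n. 2 * pi * s n ^ Suc q * (SUP k. \<bar>d n k\<bar>)) \<longlonglongrightarrow> norm \<beta> * sqrt (2 * pi) * \<bar>G q z\<bar>"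
proof -
  define e where "e n = (\<integral>u. norm (scaled_transform q (s n) (x n) (fourier (d n)) u
        - \<beta> * gauss_kernel q 0 u) \<partial>lborel)" for n
  define A where "A n = 2 * pi * s n ^ Suc q" for n
  define b where "b = norm \<beta> * sqrt (2 * pi)"
  have "b \<ge> 0" by (simp add: b_def)
  have spos: "\<forall>\<^sub>F n in sequentially. s n > 0"
    using s by (simp add: filterlim_at_top_dense)
  have approx: "\<forall>\<^sub>F n in sequentially. \<forall>k. \<bar>A n * \<bar>d n k\<bar> - b * \<bar>G q (of_int k / s n - x n)\<bar>\<bar> \<le> e n"
    using int spos
  proof eventually_elim
    case (elim n)
    let ?g = "scaled_transform q (s n) (x n) (fourier (d n))"
    show ?case
    proof
      fix k
      define y where "y = of_int k / s n - x n"
      let ?E = "\<lambda>u. exp (\<i> * complex_of_real (- u * y))"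
      have E_meas: "?E \<in> borel_measurable lborel"
        using borel_measurable_continuous_onI[of ?E] by (simp add: continuous_intros)
      have kernel: "?E u * (\<beta> * gauss_kernel q 0 u) = \<beta> * gauss_kernel q y u" for u
        by (simp add: gauss_kernel_def mult_ac)
      have int_E: "integrable lborel (\<lambda>u. ?E u * ?g u)"
        by (rule Bochner_Integration.integrable_bound[OF elim(1)])
          (use E_meas elim(1) in \<open>auto simp: norm_mult norm_exp\<close>)
      have "of_real (A n * d n k) - \<beta> * (\<integral>u. gauss_kernel q y u \<partial>lborel)
          = (\<integral>u. ?E u * ?g u \<partial>lborel) - (\<integral>u. \<beta> * gauss_kernel q y u \<partial>lborel)"
        unfolding A_def y_def local_mass_eq_integral_scaled_transform[OF fin elim(2), of q _ _ "x n"]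
        by simp
      also have "\<dots> = (\<integral>u. ?E u * ?g u - \<beta> * gauss_kernel q y u \<partial>lborel)"
        by (intro Bochner_Integration.integral_diff[symmetric] int_E integrable_mult_right integrable_gauss_kernel)
      also have "\<dots> = (\<integral>u. ?E u * (?g u - \<beta> * gauss_kernel q 0 u) \<partial>lborel)"
        by (simp only: right_diff_distrib kernel)
      also have "norm \<dots> \<le> (\<integral>u. norm (?E u * (?g u - \<beta> * gauss_kernel q 0 u)) \<partial>lborel)"
        by (rule integral_norm_bound)
      also have "\<dots> = e n"
        by (simp add: e_def norm_mult norm_exp)
      finally have "norm (of_real (A n * d n k) - \<beta> * (\<integral>u. gauss_kernel q y u \<partial>lborel)) \<le> e n" .
      then have "\<bar>norm (complex_of_real (A n * d n k)) - norm (\<beta> * (\<integral>u. gauss_kernel q y u \<partial>lborel))\<bar> \<le> e n"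
        using norm_triangle_ineq3 order_trans by blast
      moreover have "norm (complex_of_real (A n * d n k)) = A n * \<bar>d n k\<bar>"
        using elim(2) by (simp only: norm_of_real abs_mult) (simp add: A_def)
      moreover have "norm (\<beta> * (\<integral>u. gauss_kernel q y u \<partial>lborel)) = b * \<bar>G q y\<bar>"
        by (simp only: integral_gauss_kernel norm_mult norm_of_real abs_mult)
          (simp add: b_def power_abs)
      ultimately show "\<bar>A n * \<bar>d n k\<bar> - b * \<bar>G q (of_int k / s n - x n)\<bar>\<bar> \<le> e n"
        by (simp add: y_def)
    qed
  qed
  have Apos: "\<forall>\<^sub>F n in sequentially. A n > 0"
    using spos by eventually_elim (simp add: A_def)
  \<comment> \<open>Apart from giving the upper estimate, this shows that the masses are bounded in
    \<open>k\<close>, so that each of them lies below the supremum.\<close>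
  have pointwise: "\<forall>\<^sub>F n in sequentially. \<forall>k. \<bar>d n k\<bar> \<le> (b * \<bar>G q z\<bar> + e n) / A n"
    using approx Apos
  proof eventually_elim
    case (elim n)
    show ?case
    proof
      fix k
      have "A n * \<bar>d n k\<bar> \<le> b * \<bar>G q (of_int k / s n - x n)\<bar> + e n"
        using elim(1)[rule_format, of k] by linarith
      also have "\<dots> \<le> b * \<bar>G q z\<bar> + e n"
        using max \<open>b \<ge> 0\<close> by (intro add_right_mono mult_left_mono) auto
      finally show "\<bar>d n k\<bar> \<le> (b * \<bar>G q z\<bar> + e n) / A n"
        using elim(2) by (simp add: pos_le_divide_eq mult.commute)
    qed
  qed
  have upper: "\<forall>\<^sub>F n in sequentially. A n * (SUP k. \<bar>d n k\<bar>) \<le> b * \<bar>G q z\<bar> + e n"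
    using pointwise Apos
  proof eventually_elim
    case (elim n)
    have "(SUP k. \<bar>d n k\<bar>) \<le> (b * \<bar>G q z\<bar> + e n) / A n"
      using elim(1) by (intro cSUP_least) auto
    then show ?case using elim(2) by (simp add: pos_le_divide_eq mult.commute)
  qed
  \<comment> \<open>Rounding down gives a grid point that is at most \<open>z\<close> and within one
    mesh width 1 / s of it.\<close>
  define k where "k n = \<lfloor>(z + x n) * s n\<rfloor>" for n
  define y where "y n = of_int (k n) / s n - x n" for n
  have lower: "\<forall>\<^sub>F n in sequentially. b * \<bar>G q (y n)\<bar> - e n \<le> A n * (SUP k. \<bar>d n k\<bar>)"
    using approx pointwise Apos
  proof eventually_elim
    case (elim n)
    have "b * \<bar>G q (y n)\<bar> - e n \<le> A n * \<bar>d n (k n)\<bar>"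
      using elim(1)[rule_format, of "k n"] by (simp add: y_def)
    also have "\<dots> \<le> A n * (SUP k. \<bar>d n k\<bar>)"
      using elim(2,3) by (intro mult_left_mono cSUP_upper bdd_aboveI2) auto
    finally show ?case .
  qed
  have inv: "(\<lambda>n. inverse (s n)) \<longlonglongrightarrow> 0"
    using s by (rule tendsto_inverse_0_at_top)
  have "y \<longlonglongrightarrow> z"
  proof (rule tendsto_sandwich)
    show "(\<lambda>n. z - inverse (s n)) \<longlonglongrightarrow> z"
      using tendsto_diff[OF tendsto_const inv] by simp
    show "\<forall>\<^sub>F n in sequentially. z - inverse (s n) \<le> y n"
      using spos
    proof eventually_elim
      case (elim n)
      have "(z + x n) * s n - 1 \<le> of_int (k n)" unfolding k_def by linarith
      then have "((z + x n) * s n - 1) / s n \<le> of_int (k n) / s n"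
        using elim by (intro divide_right_mono) auto
      then show ?case using elim by (simp add: y_def diff_divide_distrib inverse_eq_divide)
    qed
    show "\<forall>\<^sub>F n in sequentially. y n \<le> z"
      using spos
    proof eventually_elim
      case (elim n)
      have "of_int (k n) \<le> (z + x n) * s n" unfolding k_def by linarith
      then have "of_int (k n) / s n \<le> z + x n" using elim by (simp add: pos_divide_le_eq)
      then show ?case by (simp add: y_def)
    qed
  qed simp
  then have "(\<lambda>n. G q (y n)) \<longlonglongrightarrow> G q z"
    by (rule isCont_tendsto_compose[OF DERIV_isCont[OF has_real_derivative_G]])
  then have "(\<lambda>n. b * \<bar>G q (y n)\<bar> - e n) \<longlonglongrightarrow> b * \<bar>G q z\<bar> - 0"
    using L1 unfolding e_def by (intro tendsto_intros)
  moreover have "(\<lambda>n. b * \<bar>G q z\<bar> + e n) \<longlonglongrightarrow> b * \<bar>G q z\<bar> + 0"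
    using L1 unfolding e_def by (intro tendsto_intros)
  ultimately have "(\<lambda>n. A n * (SUP k. \<bar>d n k\<bar>)) \<longlonglongrightarrow> b * \<bar>G q z\<bar>"
    by (intro tendsto_sandwich[OF lower upper]) simp_all
  then show ?thesis by (simp add: A_def b_def)
qed

text \<open>At \<xi> = u / s one has lam \<xi>^2 = u^2 / \<sigma>^2, so the quadratic term becomes
  exactly -u^2 / 2, and lam times the remainder is a constant times the null function
  \<open>h\<close>. The modulus of \<sigma> appears because the expansion determines only
  \<sigma>^2.\<close>

lemma expansion_at_0_scaling:
  fixes \<phi> :: "real \<Rightarrow> complex"
  assumes "expansion_at_0 \<phi> m \<sigma>" "\<sigma> \<noteq> 0" "filterlim lam at_top sequentially" "u \<noteq> 0"
  defines "s \<equiv> \<lambda>n. \<bar>\<sigma>\<bar> * sqrt (lam n)"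
  shows "(\<lambda>n. of_real (lam n) * (\<phi> (u / s n) - \<i> * of_real (m * (u / s n)))) \<longlonglongrightarrow> of_real (- u\<^sup>2 / 2)"
proof -
  define h where "h \<xi> = (\<phi> \<xi> - (\<i> * of_real (m * \<xi>) - of_real (\<sigma>\<^sup>2 * \<xi>\<^sup>2 / 2))) / of_real (\<xi>\<^sup>2)" for \<xi>
  have h0: "(h \<longlongrightarrow> 0) (at 0)"
    using assms(1) unfolding expansion_at_0_def h_def by (rule smalloD_tendsto)
  have lpos: "\<forall>\<^sub>F n in sequentially. lam n > 0"
    using assms(3) by (simp add: filterlim_at_top_dense)
  have "filterlim s at_top sequentially"
    unfolding s_def using assms(2)
    by (intro filterlim_tendsto_pos_mult_at_top[OF tendsto_const] filterlim_compose[OF sqrt_at_top assms(3)]) auto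
  from tendsto_mult_right_zero[OF tendsto_inverse_0_at_top[OF this], of u]
  have "(\<lambda>n. u / s n) \<longlonglongrightarrow> 0" by (simp add: divide_inverse)
  moreover have "\<forall>\<^sub>F n in sequentially. u / s n \<noteq> 0"
    using lpos by eventually_elim (use assms(2,4) in \<open>simp add: s_def\<close>)
  ultimately have xi: "filterlim (\<lambda>n. u / s n) (at 0) sequentially"
    by (simp add: filterlim_at)
  have "(\<lambda>n. of_real (u\<^sup>2 / \<sigma>\<^sup>2) * h (u / s n) + of_real (- u\<^sup>2 / 2)) \<longlonglongrightarrow> of_real (u\<^sup>2 / \<sigma>\<^sup>2) * 0 + of_real (- u\<^sup>2 / 2)"
    by (intro tendsto_intros filterlim_compose[OF h0 xi])
  moreover have "\<forall>\<^sub>F n in sequentially. of_real (u\<^sup>2 / \<sigma>\<^sup>2) * h (u / s n) + of_real (- u\<^sup>2 / 2)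
      = of_real (lam n) * (\<phi> (u / s n) - \<i> * of_real (m * (u / s n)))"
    using lpos
  proof eventually_elim
    case (elim n)
    define \<xi> where "\<xi> = u / s n"
    have "\<xi> \<noteq> 0" using elim assms(2,4) by (simp add: \<xi>_def s_def)
    have sq: "\<sigma>\<^sup>2 * (lam n * \<xi>\<^sup>2) = u\<^sup>2"
      using elim assms(2) by (simp add: \<xi>_def s_def power_divide power_mult_distrib)
    then have l: "lam n * \<xi>\<^sup>2 = u\<^sup>2 / \<sigma>\<^sup>2" using assms(2) by (simp add: field_simps)
    have "of_real (lam n) * (\<phi> \<xi> - \<i> * of_real (m * \<xi>))
        = of_real (lam n * \<xi>\<^sup>2) * h \<xi> + of_real (- (\<sigma>\<^sup>2 * (lam n * \<xi>\<^sup>2)) / 2)"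
      using \<open>\<xi> \<noteq> 0\<close> by (simp add: h_def field_simps)
    then show ?case unfolding \<xi>_def[symmetric] l sq by (simp add: assms(2))
  qed
  ultimately show ?thesis by (simp add: tendsto_cong)
qed

section \<open>Uniform bounds on the residues and the asymptotics of the local distance\<close>

theorem theorem3p3:
  fixes p :: "int pmf" and \<phi> :: "real \<Rightarrow> complex" and m \<sigma> :: real
    and M :: "nat \<Rightarrow> 'a measure" and X :: "nat \<Rightarrow> 'a \<Rightarrow> int"
    and \<mu> \<nu> :: "nat \<Rightarrow> int \<Rightarrow> real" and lam :: "nat \<Rightarrow> real"
    and psi_n chi_n :: "nat \<Rightarrow> real \<Rightarrow> complex" and psi chi :: "real \<Rightarrow> complex"
    and r :: nat and beta_n :: "nat \<Rightarrow> complex" and beta :: complex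
    and eps_n :: "nat \<Rightarrow> real \<Rightarrow> complex" and eps :: "real \<Rightarrow> complex"
  assumes "reference_law p \<phi>"
    and "expansion_at_0 \<phi> m \<sigma>"
    and "\<And>n. prob_space (M n)"
    and "\<And>n. X n \<in> measurable (M n) (count_space UNIV)"
    and "\<And>n k. \<mu> n k = measure (distr (M n) (count_space UNIV) (X n)) {k}"
    and "mod_phi \<phi> lam \<mu> psi_n psi"
    and "approximation_scheme \<phi> lam \<nu> chi_n chi"
    and "beta_n \<longlonglongrightarrow> beta"
    and "\<forall>\<^sub>F \<xi> in at 0. \<forall>n. psi_n n \<xi> - chi_n n \<xi> = beta_n n * (\<i> * of_real \<xi>) ^ (r + 1) * (1 + eps_n n \<xi>)"
    and "uniform_limit UNIV (\<lambda>\<xi> n. eps_n n \<xi>) (\<lambda>_. 0) (at 0)"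
    and "\<forall>\<^sub>F \<xi> in at 0. psi \<xi> - chi \<xi> = beta * (\<i> * of_real \<xi>) ^ (r + 1) * (1 + eps \<xi>)"
    and "(eps \<longlongrightarrow> 0) (at 0)"
  shows "(\<lambda>n. local_dist (\<mu> n) (\<nu> n)
            - norm beta * \<bar>G (r + 1) (smallest_abs_zero (r + 2))\<bar>
                / (sqrt (2 * pi) * (\<sigma>\<^sup>2 * lam n) powr (real r / 2 + 1)))
         \<in> o(\<lambda>n. 1 / lam n powr (real r / 2 + 1))"
proof -
  define q where "q = r + 1"
  define z where "z = smallest_abs_zero (r + 2)"
  define s where "s n = \<bar>\<sigma>\<bar> * sqrt (lam n)" for n
  \<comment> \<open>The mean lam m of the law with exponent lam \<phi>, in units of
    \<open>s\<close>; its phase cancels the drift i lam m \<xi>.\<close>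
  define x where "x n = lam n * m / s n" for n
  define d where "d n k = \<mu> n k - \<nu> n k" for n k
  define D where "D n \<xi> = psi_n n \<xi> - chi_n n \<xi>" for n \<xi>
  have \<sigma>: "\<sigma> \<noteq> 0" using assms(1,2) by (rule reference_law_sigma_nonzero)
  obtain c where c: "c > 0" "\<And>\<xi>. \<bar>\<xi>\<bar> \<le> pi \<Longrightarrow> Re (\<phi> \<xi>) \<le> - c * \<xi>\<^sup>2"
    using reference_law_Re_le[OF assms(1,2)] by blast
  have lam: "filterlim lam at_top sequentially" using assms(6) by (simp add: mod_phi_def)
  have lpos: "\<forall>\<^sub>F n in sequentially. lam n > 0"
    using lam by (simp add: filterlim_at_top_dense)
  have s_top: "filterlim s at_top sequentially"
    unfolding s_def using \<sigma>
    by (intro filterlim_tendsto_pos_mult_at_top[OF tendsto_const] filterlim_compose[OF sqrt_at_top lam]) auto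
  have \<mu>: "finite_signed (\<mu> n)" for n
  proof -
    interpret prob_space "M n" by (rule assms(3))
    have "prob_space (distr (M n) (count_space UNIV) (X n))" by (rule prob_space_distr) (rule assms(4))
    then have "finite_measure (distr (M n) (count_space UNIV) (X n))" by (rule prob_space.finite_measure)
    moreover have "\<mu> n = (\<lambda>k. measure (distr (M n) (count_space UNIV) (X n)) {k})"
      by (rule ext) (rule assms(5))
    ultimately show ?thesis using finite_signed_measure by simp
  qed
  have \<nu>: "finite_signed (\<nu> n)" for n using assms(7) by (simp add: approximation_scheme_def)
  have fin: "finite_signed (d n)" for n
    unfolding d_def using \<mu> \<nu> by (rule finite_signed_diff)
  have fourier_d: "fourier (d n) \<xi> = exp (of_real (lam n) * \<phi> \<xi>) * D n \<xi>" for n \<xi>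
    using assms(6,7) fourier_diff[OF \<mu> \<nu>, of n n \<xi>]
    by (simp add: d_def[abs_def] D_def mod_phi_def approximation_scheme_def right_diff_distrib)
  have D_eq: "\<forall>\<^sub>F \<xi> in at 0. \<forall>n. D n \<xi> = beta_n n * (\<i> * of_real \<xi>) ^ q * (1 + eps_n n \<xi>)"
    using assms(9) by (simp add: D_def q_def)
  have eps: "\<forall>\<^sub>F \<xi> in at 0. \<forall>n. norm (eps_n n \<xi>) < e" if "e > 0" for e
    using uniform_limitD[OF assms(10) that] by simp
  \<comment> \<open>Near 0 the factorisation gives the bound with one radius for all
    \<open>n\<close>, as \<open>eps_n\<close> is small uniformly in \<open>n\<close>. Away from 0
    the residues are bounded for large \<open>n\<close>, while |\<xi>|^q is bounded below.\<close>
  have D_bound: "\<exists>C. \<forall>\<^sub>F n in sequentially. \<forall>\<xi>. \<xi> \<noteq> 0 \<longrightarrow> norm (D n \<xi>) \<le> C * \<bar>\<xi>\<bar> ^ q"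
  proof -
    obtain \<delta> where \<delta>: "\<delta> > 0" and near: "\<And>\<xi> n. \<xi> \<noteq> 0 \<Longrightarrow> \<bar>\<xi>\<bar> < \<delta> \<Longrightarrow>
        D n \<xi> = beta_n n * (\<i> * of_real \<xi>) ^ q * (1 + eps_n n \<xi>) \<and> norm (eps_n n \<xi>) < 1"
      using eventually_conj[OF D_eq eps[of 1]] by (auto simp: eventually_at dist_real_def)
    obtain Bb where Bb: "\<And>n. norm (beta_n n) \<le> Bb"
      using convergent_imp_Bseq[OF convergentI[OF assms(8)]] by (metis BseqE)
    then have "Bb \<ge> 0" using norm_ge_zero order_trans by blast
    obtain B1 where B1: "B1 \<ge> 0" "\<And>\<xi>. norm (psi \<xi>) \<le> B1"
      using assms(6) abs_conv_fourier_series_bounded unfolding mod_phi_def by metis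
    obtain B2 where B2: "B2 \<ge> 0" "\<And>\<xi>. norm (chi \<xi>) \<le> B2"
      using assms(7) abs_conv_fourier_series_bounded unfolding mod_phi_def approximation_scheme_def by metis
    \<comment> \<open>The bounds of the two limiting residues, plus 1 for each of the two uniform
      approximations.\<close>
    define B where "B = B1 + B2 + 2"
    have "\<forall>\<^sub>F n in sequentially. \<forall>\<xi>\<in>UNIV. dist (psi_n n \<xi>) (psi \<xi>) < 1"
      using assms(6) unfolding mod_phi_def by (intro uniform_limitD) auto
    moreover have "\<forall>\<^sub>F n in sequentially. \<forall>\<xi>\<in>UNIV. dist (chi_n n \<xi>) (chi \<xi>) < 1"
      using assms(7) unfolding mod_phi_def approximation_scheme_def by (intro uniform_limitD) auto
    \<comment> \<open>The factor 2 bounds |1 + eps_n|, and B / \<delta>^q absorbs \<open>B\<close>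
      where |\<xi>| is at least \<delta>.\<close>
    ultimately have "\<forall>\<^sub>F n in sequentially. \<forall>\<xi>. \<xi> \<noteq> 0 \<longrightarrow> norm (D n \<xi>) \<le> (2 * Bb + B / \<delta> ^ q) * \<bar>\<xi>\<bar> ^ q"
    proof eventually_elim
      case (elim n)
      show ?case
      proof (intro allI impI)
        fix \<xi> :: real assume "\<xi> \<noteq> 0"
        have "B \<ge> 0" using B1 B2 by (simp add: B_def)
        show "norm (D n \<xi>) \<le> (2 * Bb + B / \<delta> ^ q) * \<bar>\<xi>\<bar> ^ q"
        proof (cases "\<bar>\<xi>\<bar> < \<delta>")
          case True
          note D = near[OF \<open>\<xi> \<noteq> 0\<close> True, of n]
          have "norm (1 + eps_n n \<xi>) \<le> 2"
            using norm_triangle_ineq[of 1 "eps_n n \<xi>"] D by simp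
          then have "norm (D n \<xi>) \<le> Bb * \<bar>\<xi>\<bar> ^ q * 2"
            using D Bb[of n] \<open>Bb \<ge> 0\<close>
            by (auto simp: norm_mult norm_power intro!: mult_mono)
          also have "\<dots> \<le> (2 * Bb + B / \<delta> ^ q) * \<bar>\<xi>\<bar> ^ q"
            using \<open>B \<ge> 0\<close> \<delta> by (simp add: algebra_simps)
          finally show ?thesis .
        next
          case False
          have "norm (D n \<xi>) \<le> norm (psi_n n \<xi> - psi \<xi>) + norm (psi \<xi>) + (norm (chi_n n \<xi> - chi \<xi>) + norm (chi \<xi>))"
            unfolding D_def
            using norm_triangle_ineq4[of "psi_n n \<xi>" "chi_n n \<xi>"]
              norm_triangle_sub[of "psi_n n \<xi>" "psi \<xi>"] norm_triangle_sub[of "chi_n n \<xi>" "chi \<xi>"]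
            by linarith
          also have "\<dots> \<le> B"
            using elim[rule_format, of \<xi>] B1(2)[of \<xi>] B2(2)[of \<xi>] by (simp add: B_def dist_norm)
          also have "\<dots> \<le> B / \<delta> ^ q * \<bar>\<xi>\<bar> ^ q"
          proof -
            have "B * \<delta> ^ q \<le> B * \<bar>\<xi>\<bar> ^ q"
              using False \<delta> \<open>B \<ge> 0\<close> by (intro mult_left_mono power_mono) auto
            then show ?thesis using \<delta> by (simp add: field_simps)
          qed
          also have "\<dots> \<le> (2 * Bb + B / \<delta> ^ q) * \<bar>\<xi>\<bar> ^ q"
            using \<open>Bb \<ge> 0\<close> by (intro mult_right_mono) auto
          finally show ?thesis .
        qed
      qed
    qed
    then show ?thesis by blast
  qed
  then obtain C where C: "\<forall>\<^sub>F n in sequentially. \<forall>\<xi>. \<xi> \<noteq> 0 \<longrightarrow> norm (D n \<xi>) \<le> C * \<bar>\<xi>\<bar> ^ q"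
    by blast
  \<comment> \<open>As s^2 = \<sigma>^2 lam, the decay rate \<open>c\<close> with respect to lam is
    the rate c / \<sigma>^2 with respect to s^2.\<close>
  have bound: "\<forall>\<^sub>F n in sequentially. \<forall>\<xi>. \<xi> \<noteq> 0 \<longrightarrow> \<bar>\<xi>\<bar> \<le> pi \<longrightarrow>
      norm (fourier (d n) \<xi>) \<le> C * \<bar>\<xi>\<bar> ^ q * exp (- (c / \<sigma>\<^sup>2) * (s n)\<^sup>2 * \<xi>\<^sup>2)"
    using C lpos
  proof eventually_elim
    case (elim n)
    show ?case
    proof (intro allI impI)
      fix \<xi> :: real assume \<xi>: "\<xi> \<noteq> 0" "\<bar>\<xi>\<bar> \<le> pi"
      have "lam n * Re (\<phi> \<xi>) \<le> lam n * (- c * \<xi>\<^sup>2)"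
        using c(2)[OF \<xi>(2)] elim(2) by (intro mult_left_mono) auto
      also have "lam n * (- c * \<xi>\<^sup>2) = - (c / \<sigma>\<^sup>2) * (s n)\<^sup>2 * \<xi>\<^sup>2"
        using elim(2) \<sigma> by (simp add: s_def power_mult_distrib)
      finally have "norm (exp (of_real (lam n) * \<phi> \<xi>)) \<le> exp (- (c / \<sigma>\<^sup>2) * (s n)\<^sup>2 * \<xi>\<^sup>2)"
        by simp
      moreover have D: "norm (D n \<xi>) \<le> C * \<bar>\<xi>\<bar> ^ q" using elim(1) \<xi>(1) by blast
      ultimately have "norm (exp (of_real (lam n) * \<phi> \<xi>)) * norm (D n \<xi>)
          \<le> exp (- (c / \<sigma>\<^sup>2) * (s n)\<^sup>2 * \<xi>\<^sup>2) * (C * \<bar>\<xi>\<bar> ^ q)"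
        by (intro mult_mono) auto
      then show "norm (fourier (d n) \<xi>) \<le> C * \<bar>\<xi>\<bar> ^ q * exp (- (c / \<sigma>\<^sup>2) * (s n)\<^sup>2 * \<xi>\<^sup>2)"
        by (simp only: fourier_d norm_mult mult_ac)
    qed
  qed
  \<comment> \<open>The factor s^q cancels the denominator of (i u / s)^q, and the phase reduces the
    exponent to lam (\<phi> - i m \<xi>), which tends to -u^2 / 2.\<close>
  have lim: "(\<lambda>n. of_real (s n ^ q) * exp (\<i> * of_real (- u * x n)) * fourier (d n) (u / s n))
      \<longlonglongrightarrow> beta * gauss_kernel q 0 u" if "u \<noteq> 0" for u
  proof -
    have spos: "\<forall>\<^sub>F n in sequentially. s n > 0"
      using s_top by (simp add: filterlim_at_top_dense)
    have "(\<lambda>n. u / s n) \<longlonglongrightarrow> 0"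
      using tendsto_mult_right_zero[OF tendsto_inverse_0_at_top[OF s_top], of u]
      by (simp add: divide_inverse)
    moreover have "\<forall>\<^sub>F n in sequentially. u / s n \<noteq> 0"
      using spos by eventually_elim (use that in simp)
    ultimately have xi: "filterlim (\<lambda>n. u / s n) (at 0) sequentially"
      by (simp add: filterlim_at)
    have "(\<lambda>n. eps_n n (u / s n)) \<longlonglongrightarrow> 0"
    proof (rule tendstoI)
      fix e :: real assume "e > 0"
      from eventually_compose_filterlim[OF eps[OF this] xi]
      show "\<forall>\<^sub>F n in sequentially. dist (eps_n n (u / s n)) 0 < e"
        by eventually_elim simp
    qed
    moreover have "(\<lambda>n. of_real (lam n) * (\<phi> (u / s n) - \<i> * of_real (m * (u / s n)))) \<longlonglongrightarrow> of_real (- u\<^sup>2 / 2)"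
      unfolding s_def using assms(2) \<sigma> lam that by (rule expansion_at_0_scaling)
    ultimately have "(\<lambda>n. exp (of_real (lam n) * (\<phi> (u / s n) - \<i> * of_real (m * (u / s n))))
        * (beta_n n * (\<i> * of_real u) ^ q * (1 + eps_n n (u / s n))))
        \<longlonglongrightarrow> exp (of_real (- u\<^sup>2 / 2)) * (beta * (\<i> * of_real u) ^ q * (1 + 0))"
      by (intro tendsto_intros assms(8))
    also have "exp (of_real (- u\<^sup>2 / 2)) * (beta * (\<i> * of_real u) ^ q * (1 + 0)) = beta * gauss_kernel q 0 u"
      by (simp only: gauss_kernel_def exp_of_real) simp
    finally have "(\<lambda>n. exp (of_real (lam n) * (\<phi> (u / s n) - \<i> * of_real (m * (u / s n))))
        * (beta_n n * (\<i> * of_real u) ^ q * (1 + eps_n n (u / s n)))) \<longlonglongrightarrow> beta * gauss_kernel q 0 u" .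
    moreover have "\<forall>\<^sub>F n in sequentially. exp (of_real (lam n) * (\<phi> (u / s n) - \<i> * of_real (m * (u / s n))))
        * (beta_n n * (\<i> * of_real u) ^ q * (1 + eps_n n (u / s n)))
        = of_real (s n ^ q) * exp (\<i> * of_real (- u * x n)) * fourier (d n) (u / s n)"
      using eventually_compose_filterlim[OF D_eq xi] spos
    proof eventually_elim
      case (elim n)
      have "exp (of_real (lam n) * (\<phi> (u / s n) - \<i> * of_real (m * (u / s n))))
          = exp (\<i> * of_real (- u * x n)) * exp (of_real (lam n) * \<phi> (u / s n))"
        unfolding exp_add[symmetric]
        by (rule arg_cong[where f = exp]) (simp add: x_def algebra_simps)
      moreover have "(\<i> * of_real u) ^ q = of_real (s n ^ q) * (\<i> * complex_of_real (u / s n)) ^ q"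
        using elim(2) by (simp add: power_mult_distrib power_divide)
      ultimately show ?case
        by (simp only: fourier_d elim(1)[rule_format, of n] mult_ac)
    qed
    ultimately show ?thesis by (rule Lim_transform_eventually)
  qed
  have a: "c / \<sigma>\<^sup>2 > 0" using c(1) \<sigma> by simp
  note limit_premises = s_top continuous_on_fourier[OF fin] a bound
  have L1: "(\<lambda>n. \<integral>u. norm (scaled_transform q (s n) (x n) (fourier (d n)) u
        - beta * gauss_kernel q 0 u) \<partial>lborel) \<longlonglongrightarrow> 0"
    by (rule scaled_transform_L1_limit(1)[OF limit_premises]) (rule lim)
  have int: "\<forall>\<^sub>F n in sequentially. integrable lborel (scaled_transform q (s n) (x n) (fourier (d n)))"
    by (rule scaled_transform_L1_limit(2)[OF limit_premises]) (rule lim)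
  have "\<bar>G q y\<bar> \<le> \<bar>G q z\<bar>" for y
    unfolding q_def z_def by (rule abs_G_le_smallest_abs_zero)
  with s_top fin int L1
  have "(\<lambda>n. 2 * pi * s n ^ Suc q * (SUP k. \<bar>d n k\<bar>)) \<longlonglongrightarrow> norm beta * sqrt (2 * pi) * \<bar>G q z\<bar>"
    by (rule local_dist_limit)
  then have limit: "(\<lambda>n. 2 * pi * s n ^ Suc q * local_dist (\<mu> n) (\<nu> n)) \<longlonglongrightarrow> norm beta * sqrt (2 * pi) * \<bar>G q z\<bar>"
    by (simp add: local_dist_def d_def)
  \<comment> \<open>Since q + 1 = r + 2, the factor 2 pi s^(q + 1) is \<open>K\<close> times
    lam^(r/2 + 1); division by \<open>K\<close> leaves the normalisation of the claim.\<close>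
  define K where "K = 2 * pi * \<bar>\<sigma>\<bar> ^ Suc q"
  have "K > 0" using \<sigma> by (simp add: K_def)
  have "(\<lambda>n. (2 * pi * s n ^ Suc q * local_dist (\<mu> n) (\<nu> n) - norm beta * sqrt (2 * pi) * \<bar>G q z\<bar>) / K) \<longlonglongrightarrow> 0"
    using tendsto_divide[OF LIM_zero[OF limit] tendsto_const, of K] \<open>K > 0\<close> by simp
  moreover have "\<forall>\<^sub>F n in sequentially.
      (2 * pi * s n ^ Suc q * local_dist (\<mu> n) (\<nu> n) - norm beta * sqrt (2 * pi) * \<bar>G q z\<bar>) / K
      = (local_dist (\<mu> n) (\<nu> n) - norm beta * \<bar>G (r + 1) (smallest_abs_zero (r + 2))\<bar>
          / (sqrt (2 * pi) * (\<sigma>\<^sup>2 * lam n) powr (real r / 2 + 1))) / (1 / lam n powr (real r / 2 + 1))"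
    using lpos
  proof eventually_elim
    case (elim n)
    define P where "P = lam n powr (real r / 2 + 1)"
    have "P > 0" using elim by (simp add: P_def)
    have half: "sqrt y ^ Suc q = y powr (real r / 2 + 1)" if "y > 0" for y
    proof -
      have "sqrt y ^ Suc q = (y powr (1 / 2)) powr real (Suc q)"
        using that powr_realpow[of "sqrt y" "Suc q"] by (simp only: powr_half_sqrt) simp
      also have "\<dots> = y powr (real r / 2 + 1)"
        by (simp add: powr_powr q_def add_divide_distrib add.commute)
      finally show ?thesis .
    qed
    have s_pow: "s n ^ Suc q = \<bar>\<sigma>\<bar> ^ Suc q * P"
      unfolding s_def power_mult_distrib P_def half[OF elim] ..
    have "(\<sigma>\<^sup>2 * lam n) powr (real r / 2 + 1) = sqrt (\<sigma>\<^sup>2 * lam n) ^ Suc q"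
      using \<sigma> elim by (intro half[symmetric]) simp
    also have "\<dots> = \<bar>\<sigma>\<bar> ^ Suc q * P"
      by (simp only: real_sqrt_mult real_sqrt_abs power_mult_distrib P_def half[OF elim])
    finally have powr: "(\<sigma>\<^sup>2 * lam n) powr (real r / 2 + 1) = \<bar>\<sigma>\<bar> ^ Suc q * P" .
    \<comment> \<open>With 2 pi split in two, one square root cancels against the limit and the
      other remains in the denominator of the claim.\<close>
    have K: "K = sqrt (2 * pi) * sqrt (2 * pi) * \<bar>\<sigma>\<bar> ^ Suc q" by (simp add: K_def)
    have nz: "sqrt (2 * pi) \<noteq> 0" "\<bar>\<sigma>\<bar> ^ Suc q \<noteq> 0" "P \<noteq> 0" using \<sigma> \<open>P > 0\<close> by auto
    have "(2 * pi * s n ^ Suc q * local_dist (\<mu> n) (\<nu> n) - norm beta * sqrt (2 * pi) * \<bar>G q z\<bar>) / K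
        = local_dist (\<mu> n) (\<nu> n) * P - norm beta * \<bar>G q z\<bar> / (sqrt (2 * pi) * \<bar>\<sigma>\<bar> ^ Suc q)"
      using nz unfolding diff_divide_distrib s_pow
      by (simp add: K_def) (simp add: field_simps)
    also have "\<dots> = (local_dist (\<mu> n) (\<nu> n) - norm beta * \<bar>G q z\<bar> / (sqrt (2 * pi) * (\<bar>\<sigma>\<bar> ^ Suc q * P))) / (1 / P)"
      using nz by (simp add: left_diff_distrib)
    finally show ?case unfolding powr by (simp add: q_def z_def P_def)
  qed
  ultimately have "(\<lambda>n. (local_dist (\<mu> n) (\<nu> n) - norm beta * \<bar>G (r + 1) (smallest_abs_zero (r + 2))\<bar>
          / (sqrt (2 * pi) * (\<sigma>\<^sup>2 * lam n) powr (real r / 2 + 1))) / (1 / lam n powr (real r / 2 + 1))) \<longlonglongrightarrow> 0"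
    by (rule Lim_transform_eventually)
  then show ?thesis
    by (rule smalloI_tendsto) (use lpos in eventually_elim, simp)
qed

end
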